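(* Let $X\in\mathbb{R}^{n\times p}$, $0\ne M\in\mathcal{P}^{\rm SLOPE}_p$, $k=\|M\|_\infty$ and $\Lambda=(\lambda_1,\dots,\lambda_p)'\in\mathbb{R}^{p+}$. Consider a sequence of signals $(\beta^{(r)})_{r\ge1}$ with pattern $M$: $\beta^{(r)}=U_Ms^{(r)}$ with $s^{(r)}\in\mathbb{R}^{k+}$, whose strength is increasing in the sense that $$\Delta_r=\min_{1\le i\le k}\left(s_i^{(r)}-s_{i+1}^{(r)}\right)\xrightarrow[r\to\infty]{}\infty,\quad\text{with the convention } s_{k+1}^{(r)}=0,$$ and let $Y^{(r)}=X\beta^{(r)}+\varepsilon$, where $\varepsilon$ is a vector in $\mathbb{R}^n$ (not depending on $r$). (i) Let $\alpha>0$. If $\varepsilon$ is random, then $$\lim_{r\to\infty}\mathbb{P}\left(\exists\,\hat\beta\in S_{X,\alpha\Lambda}(Y^{(r)})\text{ such that }\mathrm{patt}(\hat\beta)=M\right)=\begin{cases}\mathbb{P}\left(J^*_\Lambda(\pi_\alpha)\le1\right)&\text{if }\tilde\Lambda_M\in\mathrm{col}(\tilde X_M'),\\ 0&\text{if }\tilde\Lambda_M\notin\mathrm{col}(\tilde X_M'),\end{cases}$$ where $\pi_\alpha=X'(\tilde X_M')^+\tilde\Lambda_M+\frac1\alpha X'(I_n-\tilde P_M)\varepsilon$. (ii) If $(\alpha_r)_{r\ge1}$ is a sequence of positive numbers with $\alpha_r\to\infty$ and $\alpha_r/\Delta_r\to0$ as $r\to\infty$, and $$X'(\tilde X_M')^+\tilde\Lambda_M\in\mathrm{ri}(\partial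 J_\Lambda(M)),$$ then for any $\varepsilon\in\mathbb{R}^n$ there exists $r_0>0$ such that for all $r\ge r_0$ there exists $\hat\beta\in S_{X,\alpha_r\Lambda}(Y^{(r)})$ with $\mathrm{patt}(\hat\beta)=M$.
   Context: Notation: $A'$ is the transpose, $A^+$ the Moore-Penrose pseudo-inverse, $\mathrm{col}(A)$ the column space, $\mathrm{ri}(C)$ the relative interior of a convex set $C$ (interior relative to its affine hull), $\|\cdot\|_\infty$ the maximum absolute entry. $\mathbb{R}^{k+}=\{\kappa\in\mathbb{R}^k:\kappa_1>\dots>\kappa_k>0\}$. SLOPE pattern: for $b\in\mathbb{R}^p$, $\mathrm{patt}(b)_i=\mathrm{sign}(b_i)\,\mathrm{rank}(|b|)_i$, where $k$ is the number of distinct nonzero values in $\{|b_1|,\dots,|b_p|\}$, $\mathrm{rank}(|b|)_i\in\{0,1,\dots,k\}$, $\mathrm{rank}(|b|)_i=0$ if $b_i=0$, $\mathrm{rank}(|b|)_i>0$ if $b_i\ne0$, and $\mathrm{rank}(|b|)_i<\mathrm{rank}(|b|)_j$ if $|b_i|<|b_j|$ (so $\mathrm{rank}(|b|)_i$ is the number of distinct nonzero values of $|b_1|,\dots,|b_p|$ that are $\le|b_i|$). $\mathcal{P}^{\rm SLOPE}_p=\mathrm{patt}(\mathbb{R}^p)$. For $0\ne M\in\mathcal{P}^{\rm SLOPE}_p$ with $k=\|M\|_\infty$, the pattern matrix $U_M\in\mathbb{R}^{p\times k}$ is $(U_M)_{ij}=\mathrm{sign}(M_i)\mathbf 1_{(|M_i|=k+1-j)}$.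 $|M|_\downarrow$ is the vector of absolute values of the components of $M$ in nonincreasing order. $\tilde X_M=XU_M$, $\tilde\Lambda_M=(U_{|M|_\downarrow})'\Lambda\in\mathbb{R}^k$, and $\tilde P_M=\tilde X_M\tilde X_M^+$ is the orthogonal projection onto $\mathrm{col}(\tilde X_M)$. For $\Lambda\in\mathbb{R}^{p+}$: $J_\Lambda(b)=\sum_{i=1}^p\lambda_i|b|_{(i)}$, where $|b|_{(1)}\ge\dots\ge|b|_{(p)}$ are the sorted absolute values of the components of $b$; the dual norm is $J^*_\Lambda(b)=\max_{1\le j\le p}\frac{\sum_{i=1}^j|b|_{(i)}}{\sum_{i=1}^j\lambda_i}$; $\partial J_\Lambda(b)=\{v\in\mathbb{R}^p: J_\Lambda(z)\ge J_\Lambda(b)+v'(z-b)\ \forall z\in\mathbb{R}^p\}$. $S_{X,\alpha\Lambda}(Y)=\arg\min_{b\in\mathbb{R}^p}\{\frac12\|Y-Xb\|_2^2+\alpha J_\Lambda(b)\}$ is the set of SLOPE minimizers. *)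

theory Defs
  imports "HOL-Probability.Probability"
begin

(* Coordinates of vectors in R^p and R^k are indexed by types of class {finite, linorder};
   such a type is order-isomorphic to {1..p} (resp. {1..k}) via the 1-based position pos. *)

definition pos :: "'a::{finite,linorder} \<Rightarrow> nat" where
  "pos i = card {j. j \<le> i}"

definition decr_pos_vecs :: "(real ^ 'k::{finite,linorder}) set" where
  "decr_pos_vecs = {\<kappa>. (\<forall>i j. i < j \<longrightarrow> \<kappa> $ i > \<kappa> $ j) \<and> (\<forall>i. \<kappa> $ i > 0)}"

(* Min {i<..} is the index following i; s_{k+1} = 0 at the last index. *)
definition min_gap :: "real ^ 'k::{finite,linorder} \<Rightarrow> real" where
  "min_gap s = Min (range (\<lambda>i. s $ i - (if {i<..} = {} then 0 else s $ Min {i<..})))"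


definition abs_rank :: "real ^ 'p \<Rightarrow> 'p \<Rightarrow> nat" where
  "abs_rank b i = card {v \<in> range (\<lambda>j. \<bar>b $ j\<bar>). v \<noteq> 0 \<and> v \<le> \<bar>b $ i\<bar>}"

definition patt :: "real ^ 'p \<Rightarrow> real ^ 'p" where
  "patt b = (\<chi> i. sgn (b $ i) * real (abs_rank b i))"

definition slope_patterns :: "(real ^ 'p) set" where
  "slope_patterns = range patt"

(* The number of columns is the cardinality of the result's index type 'k;
   it is the pattern matrix of M only when CARD('k) is the maximum absolute entry of M. *)
definition pattern_matrix :: "real ^ 'p \<Rightarrow> real ^ 'k::{finite,linorder} ^ 'p" where
  "pattern_matrix M =
     (\<chi> i j. sgn (M $ i) *
        (if \<bar>M $ i\<bar> = real CARD('k) + 1 - real (pos j) then 1 else 0))"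

(* Entry i is the pos i-th largest absolute value, counted with multiplicity. *)
definition abs_sorted :: "real ^ 'p::{finite,linorder} \<Rightarrow> real ^ 'p::{finite,linorder}" where
  "abs_sorted b =
     (\<chi> i. rev (sort (map (\<lambda>j. \<bar>b $ j\<bar>) (sorted_list_of_set UNIV))) ! (pos i - 1))"


definition is_pinv :: "real ^ 'n ^ 'm \<Rightarrow> real ^ 'm ^ 'n \<Rightarrow> bool" where
  "is_pinv A B \<longleftrightarrow>
     A ** B ** A = A \<and> B ** A ** B = B \<and>
     transpose (A ** B) = A ** B \<and> transpose (B ** A) = B ** A"

definition pinv :: "real ^ 'n ^ 'm \<Rightarrow> real ^ 'm ^ 'n" where
  "pinv A = (THE B. is_pinv A B)"

definition col_space :: "real ^ 'n ^ 'm \<Rightarrow> (real ^ 'm) set" where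
  "col_space A = span (columns A)"

definition col_proj :: "real ^ 'n ^ 'm \<Rightarrow> real ^ 'm ^ 'm" where
  "col_proj A = A ** pinv A"


definition slope_norm :: "real ^ 'p::{finite,linorder} \<Rightarrow> real ^ 'p::{finite,linorder} \<Rightarrow> real" where
  "slope_norm \<Lambda> b = (\<Sum>i\<in>UNIV. \<Lambda> $ i * abs_sorted b $ i)"

definition slope_dual_norm :: "real ^ 'p::{finite,linorder} \<Rightarrow> real ^ 'p::{finite,linorder} \<Rightarrow> real" where
  "slope_dual_norm \<Lambda> b =
     Max (range (\<lambda>j. (\<Sum>i\<in>{..j}. abs_sorted b $ i) / (\<Sum>i\<in>{..j}. \<Lambda> $ i)))"

definition subdifferential :: "(real ^ 'p \<Rightarrow> real) \<Rightarrow> real ^ 'p \<Rightarrow> (real ^ 'p) set" where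
  "subdifferential f b = {v. \<forall>z. f z \<ge> f b + v \<bullet> (z - b)}"

definition slope_minimizers ::
    "real ^ 'p::{finite,linorder} ^ 'n \<Rightarrow> real \<Rightarrow> real ^ 'p::{finite,linorder} \<Rightarrow> real ^ 'n
     \<Rightarrow> (real ^ 'p::{finite,linorder}) set" where
  "slope_minimizers X \<alpha> \<Lambda> Y =
     {b. is_arg_min (\<lambda>b. 1/2 * (norm (Y - X *v b))\<^sup>2 + \<alpha> * slope_norm \<Lambda> b) (\<lambda>_. True) b}"

definition X_tilde ::
    "real ^ 'p ^ 'n \<Rightarrow> real ^ 'p \<Rightarrow> real ^ 'k::{finite,linorder} ^ 'n" where
  "X_tilde X M = X ** pattern_matrix M"

definition \<Lambda>_tilde ::
    "real ^ 'p::{finite,linorder} \<Rightarrow> real ^ 'p::{finite,linorder} \<Rightarrow> real ^ 'k::{finite,linorder}" where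
  "\<Lambda>_tilde \<Lambda> M = transpose (pattern_matrix (abs_sorted M)) *v \<Lambda>"

end

theory Submission
  imports Defs
begin

text \<open>
  Write \<open>U\<close> for the pattern matrix of \<open>M\<close>, \<open>XM = X ** U\<close> for the reduced design,
  \<open>\<Lambda>M\<close> for the reduced penalty vector and \<open>J\<close> for the SLOPE norm.

  The vectors with pattern \<open>M\<close> are exactly the \<open>U *v t\<close> with \<open>t\<close> in the open cone of strictly
  decreasing positive vectors (\<open>patt_eq_iff\<close>), and on them \<open>J\<close> is linear:
  \<open>J (U *v t) = \<Lambda>M \<bullet> t\<close>. Since the cone is open, the subdifferential of \<open>J\<close> is the same at all
  these points, namely the set of \<open>v\<close> in the dual unit ball with \<open>transpose U *v v = \<Lambda>M\<close>
  (\<open>subdifferential_slope_norm_pattern\<close>). The optimality condition for \<open>U *v t\<close>, when the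
  response is \<open>X *v (U *v s) + e\<close>, therefore splits into two parts: the normal equation
  \<open>transpose XM *v (XM *v (s - t)) = \<alpha> *\<^sub>R \<Lambda>M - transpose XM *v e\<close>, and a dual norm bound on the
  scaled residual correlation. The normal equation is solvable in \<open>t\<close> only if \<open>\<Lambda>M\<close> lies in the
  row space of \<open>XM\<close>; and whichever solution is taken, it fixes the fitted value \<open>XM *v (s - t)\<close>,
  so the residual correlation is always the vector \<open>\<pi>\<^sub>\<alpha>\<close> of the theorem. This is
  \<open>pattern_recovery_iff\<close>: the pattern is recovered iff \<open>\<Lambda>M\<close> is in the row space, \<open>\<pi>\<^sub>\<alpha>\<close> is in the
  dual ball, and some solution \<open>t\<close> lies in the cone. One solution is \<open>s\<close> minus a shift that does
  not depend on \<open>s\<close>, and it lies in the cone as soon as the gaps of \<open>s\<close> exceed twice the norm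
  of the shift.

  For the limit of the probabilities, the first two conditions do not depend on \<open>r\<close>. If the first
  fails, all probabilities are 0; if it holds, then for each outcome the third holds for all
  large \<open>r\<close>, and dominated convergence finishes. The events are
  Borel because the open cone is a countable union of compact sets.

  When the tuning parameter grows, the shift grows at most linearly in \<open>\<alpha>\<close>, hence is eventually
  dominated by the gaps, while \<open>\<pi>\<^sub>\<alpha>\<close> tends to the point assumed to be in the relative interior.
  The difference is annihilated by \<open>transpose U\<close>, and every such direction lies in the affine
  hull of the subdifferential (\<open>add_mem_affine_hull_subdifferential\<close>), so \<open>\<pi>\<^sub>\<alpha>\<close> is eventually in
  the subdifferential. The description of the affine hull is the place where the strict
  decrease of the weights enters.
\<close>

section \<open>Positions and sorting\<close>

lemma pos_le_iff: "pos i \<le> pos j \<longleftrightarrow> i \<le> j"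
proof
  assume "i \<le> j"
  then show "pos i \<le> pos j" unfolding pos_def by (intro card_mono) auto
next
  assume le: "pos i \<le> pos j"
  show "i \<le> j"
  proof (rule ccontr)
    assume "\<not> i \<le> j"
    then have "{l. l \<le> j} \<subset> {l. l \<le> i}" by force
    then have "pos j < pos i" unfolding pos_def by (intro psubset_card_mono) auto
    with le show False by simp
  qed
qed

lemma pos_less_iff: "pos i < pos j \<longleftrightarrow> i < j"
  using pos_le_iff[of j i] by (simp add: not_le [symmetric])

lemma pos_eq_iff: "pos i = pos j \<longleftrightarrow> i = j"
  by (metis order.refl order_antisym pos_le_iff)

lemma pos_bounds: "1 \<le> pos i" "pos (i :: 'a::{finite,linorder}) \<le> CARD('a)"
proof -
  have "card {i} \<le> pos i" unfolding pos_def by (intro card_mono) auto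
  then show "1 \<le> pos i" by simp
  show "pos (i :: 'a) \<le> CARD('a)" unfolding pos_def by (intro card_mono) auto
qed

lemma range_pos: "range (pos :: 'a::{finite,linorder} \<Rightarrow> nat) = {1..CARD('a)}"
proof (rule card_subset_eq)
  show "range (pos :: 'a \<Rightarrow> nat) \<subseteq> {1..CARD('a)}" using pos_bounds by auto
  show "card (range (pos :: 'a \<Rightarrow> nat)) = card {1..CARD('a)}"
    by (simp add: card_image inj_on_def pos_eq_iff)
qed simp

lemma nth_pos: "sorted_list_of_set UNIV ! (pos i - 1) = (i :: 'a::{finite,linorder})"
proof -
  let ?L = "sorted_list_of_set (UNIV :: 'a set)"
  have "i \<in> set ?L" by simp
  then obtain n where n: "n < length ?L" "?L ! n = i" by (metis in_set_conv_nth)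
  have strict: "a < b \<Longrightarrow> b < length ?L \<Longrightarrow> ?L ! a < ?L ! b" for a b
    by (rule sorted_wrt_nth_less[OF strict_sorted_list_of_set])
  \<comment> \<open>the position of the entry with list index \<open>n\<close> is \<open>n + 1\<close>\<close>
  have "{j. j \<le> i} = (!) ?L ` {..n}"
  proof (intro set_eqI iffI)
    fix j assume "j \<in> {j. j \<le> i}"
    have "j \<in> set ?L" by simp
    then obtain m where m: "m < length ?L" "?L ! m = j" by (metis in_set_conv_nth)
    have "m \<le> n" using strict[of n m] m n \<open>j \<in> {j. j \<le> i}\<close> by force
    then show "j \<in> (!) ?L ` {..n}" using m by auto
  next
    fix j assume "j \<in> (!) ?L ` {..n}"
    then obtain m where "m \<le> n" "j = ?L ! m" by auto
    then show "j \<in> {j. j \<le> i}" using strict[of m n] n by (cases "m = n") auto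
  qed
  moreover have "inj_on ((!) ?L) {..n}"
    using n by (intro inj_on_nth) auto
  ultimately have "pos i = n + 1" unfolding pos_def by (simp add: card_image)
  with n show ?thesis by simp
qed

text \<open>
  Working with a sorting permutation instead of the sorted vector avoids lists: ties are resolved
  by the choice of \<open>\<rho>\<close>, and one \<open>\<rho>\<close> can sort several vectors at once.
\<close>
definition sorts_abs :: "('p \<Rightarrow> 'p) \<Rightarrow> real ^ 'p::{finite,linorder} \<Rightarrow> bool" where
  "sorts_abs \<rho> z \<longleftrightarrow> bij \<rho> \<and> (\<forall>i j. i \<le> j \<longrightarrow> \<bar>z $ \<rho> j\<bar> \<le> \<bar>z $ \<rho> i\<bar>)"

lemma sorts_abs_exists: "\<exists>\<rho>. sorts_abs \<rho> z"
proof -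
  let ?L = "sorted_list_of_set (UNIV :: 'a set)"
  let ?f = "\<lambda>i. \<bar>z $ i\<bar>"
  define L' where "L' = rev (sort_key ?f ?L)"
  define \<rho> :: "'a \<Rightarrow> 'a" where "\<rho> i = L' ! (pos i - 1)" for i
  have len: "length L' = CARD('a)" by (simp add: L'_def)
  have idx: "pos i - 1 < CARD('a)" for i :: 'a using pos_bounds[of i] by linarith
  have "inj \<rho>"
  proof (rule injI)
    fix i j assume "\<rho> i = \<rho> j"
    moreover have "distinct L'" by (simp add: L'_def)
    ultimately have "pos i - 1 = pos j - 1"
      unfolding \<rho>_def using idx[of i] idx[of j] len by (simp add: nth_eq_iff_index_eq)
    then show "i = j" using pos_bounds(1)[of i] pos_bounds(1)[of j] pos_eq_iff by fastforce
  qed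
  then have "bij \<rho>" by (simp add: bij_def finite_UNIV_inj_surj)
  moreover have "?f (\<rho> j) \<le> ?f (\<rho> i)" if "i \<le> j" for i j
  proof -
    have "sorted (rev (map ?f L'))" by (simp add: L'_def flip: rev_map)
    moreover have "pos i - 1 \<le> pos j - 1" using that by (intro diff_le_mono) (simp add: pos_le_iff)
    ultimately show ?thesis
      unfolding \<rho>_def using idx[of j] idx[of i] len
      by (auto simp: sorted_rev_iff_nth_mono)
  qed
  ultimately show ?thesis unfolding sorts_abs_def by blast
qed

lemma abs_sorted_eq:
  assumes "sorts_abs \<rho> z"
  shows "abs_sorted z $ i = \<bar>z $ \<rho> i\<bar>"
proof -
  let ?L = "sorted_list_of_set (UNIV :: 'a set)"
  let ?ys = "map (\<lambda>i. \<bar>z $ \<rho> i\<bar>) ?L"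
  have \<rho>: "bij \<rho>" "\<And>i j. i \<le> j \<Longrightarrow> \<bar>z $ \<rho> j\<bar> \<le> \<bar>z $ \<rho> i\<bar>"
    using assms by (auto simp: sorts_abs_def)
  have L: "mset ?L = mset_set UNIV" using mset_set_set[of ?L] by simp
  have "mset ?ys = image_mset (\<lambda>i. \<bar>z $ i\<bar>) (image_mset \<rho> (mset_set UNIV))"
    by (simp add: multiset.map_comp comp_def L)
  also have "image_mset \<rho> (mset_set UNIV) = mset_set UNIV"
    using \<rho>(1) by (simp add: image_mset_mset_set bij_def)
  finally have "mset (rev ?ys) = mset (map (\<lambda>i. \<bar>z $ i\<bar>) ?L)" by (simp add: L)
  moreover have "sorted (rev ?ys)"
    unfolding sorted_rev_iff_nth_mono
    using \<rho>(2) sorted_nth_mono[OF sorted_sorted_list_of_set[of "UNIV :: 'a set"]] by auto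
  ultimately have "sort (map (\<lambda>i. \<bar>z $ i\<bar>) ?L) = rev ?ys" by (rule properties_for_sort)
  then have "abs_sorted z $ i = ?ys ! (pos i - 1)" by (simp add: abs_sorted_def)
  also have "\<dots> = \<bar>z $ \<rho> (?L ! (pos i - 1))\<bar>"
  proof (rule nth_map)
    show "pos i - 1 < length ?L" using pos_bounds[of i] by simp
  qed
  also have "\<dots> = \<bar>z $ \<rho> i\<bar>" by (simp only: nth_pos)
  finally show ?thesis .
qed

text \<open>
  An exchange argument: the entries of \<open>T\<close> beyond \<open>j\<close> are at most \<open>g j\<close>, the entries of the
  initial segment that are missing from \<open>T\<close> are at least \<open>g j\<close>, and there are equally many of
  both.
\<close>
lemma sum_le_initial_sum:
  fixes g :: "'a::{finite,linorder} \<Rightarrow> real"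
  assumes anti: "\<And>i j. i \<le> j \<Longrightarrow> g j \<le> g i"
    and card: "card T = card {..j}"
  shows "sum g T \<le> sum g {..j}"
proof -
  have eq: "card (T - {..j}) = card ({..j} - T)"
    using card by (simp add: card_Diff_subset_Int Int_commute)
  have "sum g (T - {..j}) \<le> (\<Sum>i\<in>T - {..j}. g j)"
    by (intro sum_mono anti) auto
  also have "\<dots> = (\<Sum>i\<in>{..j} - T. g j)" using eq by simp
  also have "\<dots> \<le> sum g ({..j} - T)"
    by (intro sum_mono anti) auto
  finally show ?thesis
    using sum.Int_Diff[of T g "{..j}"] sum.Int_Diff[of "{..j}" g T] by (simp add: Int_commute)
qed

text \<open>
  Summation by parts in inequality form. The lower bound \<open>t\<close> of the decreasing factor \<open>d\<close> is
  there to make the induction work: when a new last index \<open>b\<close> is added, the induction hypothesis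
  is used with \<open>t = d b\<close>.
\<close>
lemma sum_mult_nonneg_if_partial_sums_nonneg:
  fixes e d :: "'a::linorder \<Rightarrow> real"
  assumes "finite A"
    and "\<And>j. j \<in> A \<Longrightarrow> 0 \<le> (\<Sum>i\<in>{i\<in>A. i \<le> j}. e i)"
    and "\<And>i j. i \<in> A \<Longrightarrow> j \<in> A \<Longrightarrow> i \<le> j \<Longrightarrow> d j \<le> d i"
    and "\<And>i. i \<in> A \<Longrightarrow> t \<le> d i"
  shows "t * sum e A \<le> (\<Sum>i\<in>A. e i * d i)"
  using assms
proof (induction A arbitrary: t rule: finite_linorder_max_induct)
  case (insert b A)
  have b: "b \<notin> A" using insert.hyps by auto
  have "0 \<le> (\<Sum>i\<in>{i\<in>A. i \<le> j}. e i)" if "j \<in> A" for j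
  proof -
    have "{i\<in>insert b A. i \<le> j} = {i\<in>A. i \<le> j}" using that insert.hyps by force
    then show ?thesis using insert.prems(1)[of j] that by simp
  qed
  then have IH: "d b * sum e A \<le> (\<Sum>i\<in>A. e i * d i)"
    using insert.prems(2) insert.hyps(2) by (intro insert.IH) (auto intro: less_imp_le)
  have "{i\<in>insert b A. i \<le> b} = insert b A" using insert.hyps by force
  then have "0 \<le> sum e (insert b A)" using insert.prems(1)[of b] by simp
  then have "t * sum e (insert b A) \<le> d b * sum e (insert b A)"
    using insert.prems(3)[of b] by (intro mult_right_mono) auto
  also have "\<dots> \<le> (\<Sum>i\<in>insert b A. e i * d i)"
    using IH b insert.hyps(1) by (simp add: algebra_simps)
  finally show ?case .
qed simp

lemma sum_mult_mono_if_partial_sums_mono: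
  fixes a c d :: "'a::{finite,linorder} \<Rightarrow> real"
  assumes part: "\<And>j. sum a {..j} \<le> sum c {..j}"
    and anti: "\<And>i j. i \<le> j \<Longrightarrow> d j \<le> d i"
    and nonneg: "\<And>i. 0 \<le> d i"
  shows "(\<Sum>i\<in>UNIV. a i * d i) \<le> (\<Sum>i\<in>UNIV. c i * d i)"
proof -
  have "0 * (\<Sum>i\<in>UNIV. c i - a i) \<le> (\<Sum>i\<in>UNIV. (c i - a i) * d i)"
  proof (rule sum_mult_nonneg_if_partial_sums_nonneg)
    show "0 \<le> (\<Sum>i\<in>{i\<in>UNIV. i \<le> j}. c i - a i)" for j
      using part[of j] by (simp add: sum_subtractf atMost_def)
  qed (use anti nonneg in auto)
  then show ?thesis by (simp add: left_diff_distrib sum_subtractf)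
qed

lemma sum_le_initial_sum_abs_sorted:
  assumes "card T = card {..j}"
  shows "(\<Sum>i\<in>T. \<bar>z $ i\<bar>) \<le> (\<Sum>i\<in>{..j}. abs_sorted z $ i)"
proof -
  obtain \<rho> where \<rho>: "sorts_abs \<rho> z" using sorts_abs_exists by blast
  then have bij: "bij \<rho>" by (simp add: sorts_abs_def)
  have "(\<Sum>i\<in>T. \<bar>z $ i\<bar>) = (\<Sum>i\<in>\<rho> -` T. \<bar>z $ \<rho> i\<bar>)"
    using bij by (intro sum.reindex_bij_betw[symmetric])
      (auto simp: bij_betw_def bij_def surj_image_vimage_eq intro: inj_on_subset)
  also have "\<dots> \<le> (\<Sum>i\<in>{..j}. \<bar>z $ \<rho> i\<bar>)"
  proof (rule sum_le_initial_sum)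
    show "card (\<rho> -` T) = card {..j}"
      using assms bij by (simp add: card_vimage_inj bij_def)
  qed (use \<rho> in \<open>auto simp: sorts_abs_def\<close>)
  finally show ?thesis using \<rho> by (simp add: abs_sorted_eq)
qed

lemma decr_pos_vecsD:
  assumes "\<Lambda> \<in> decr_pos_vecs"
  shows "0 < \<Lambda> $ i" "i \<le> j \<Longrightarrow> \<Lambda> $ j \<le> \<Lambda> $ i" "i < j \<Longrightarrow> \<Lambda> $ j < \<Lambda> $ i"
  using assms by (auto simp: decr_pos_vecs_def le_less)

section \<open>The SLOPE norm and its dual\<close>

lemma slope_norm_eq:
  assumes "sorts_abs \<rho> z"
  shows "slope_norm \<Lambda> z = (\<Sum>i\<in>UNIV. \<Lambda> $ i * \<bar>z $ \<rho> i\<bar>)"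
  by (simp add: slope_norm_def abs_sorted_eq[OF assms])

text \<open>
  The rearrangement inequality. Together with \<open>slope_norm_eq\<close> it exhibits the SLOPE norm as a
  maximum over permutations, which gives convexity.
\<close>
lemma slope_norm_ge:
  assumes \<Lambda>: "\<Lambda> \<in> decr_pos_vecs" and bij: "bij \<rho>"
  shows "(\<Sum>i\<in>UNIV. \<Lambda> $ i * \<bar>z $ \<rho> i\<bar>) \<le> slope_norm \<Lambda> z"
proof -
  obtain \<tau> where \<tau>: "sorts_abs \<tau> z" using sorts_abs_exists by blast
  then have b: "bij \<tau>" by (simp add: sorts_abs_def)
  \<comment> \<open>reindexing by \<open>\<pi>\<close> sorts \<open>z\<close> and permutes the weights instead\<close>
  define \<pi> where "\<pi> = inv \<rho> \<circ> \<tau>"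
  have \<pi>: "bij \<pi>" using b bij by (simp add: \<pi>_def bij_comp bij_imp_bij_inv)
  have "(\<Sum>i\<in>UNIV. \<Lambda> $ i * \<bar>z $ \<rho> i\<bar>) = (\<Sum>i\<in>UNIV. \<Lambda> $ \<pi> i * \<bar>z $ \<rho> (\<pi> i)\<bar>)"
    using \<pi> by (intro sum.reindex_bij_betw[symmetric])
  also have "\<dots> = (\<Sum>i\<in>UNIV. \<Lambda> $ \<pi> i * \<bar>z $ \<tau> i\<bar>)"
    using bij by (simp add: \<pi>_def bij_is_surj surj_f_inv_f)
  also have "\<dots> \<le> (\<Sum>i\<in>UNIV. \<Lambda> $ i * \<bar>z $ \<tau> i\<bar>)"
  proof (rule sum_mult_mono_if_partial_sums_mono)
    fix j
    have "(\<Sum>i\<in>{..j}. \<Lambda> $ \<pi> i) = (\<Sum>i\<in>\<pi> ` {..j}. \<Lambda> $ i)"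
      using \<pi> by (simp add: sum.reindex bij_def inj_on_def)
    also have "\<dots> \<le> (\<Sum>i\<in>{..j}. \<Lambda> $ i)"
    proof (rule sum_le_initial_sum)
      show "card (\<pi> ` {..j}) = card {..j}"
        using \<pi> by (intro card_image) (auto simp: bij_def inj_on_def)
    qed (use \<Lambda> decr_pos_vecsD in blast)
    finally show "(\<Sum>i\<in>{..j}. \<Lambda> $ \<pi> i) \<le> (\<Sum>i\<in>{..j}. \<Lambda> $ i)" .
  qed (use \<tau> in \<open>auto simp: sorts_abs_def\<close>)
  also have "\<dots> = slope_norm \<Lambda> z" using \<tau> by (simp add: slope_norm_eq)
  finally show ?thesis .
qed

lemma slope_norm_scale: "slope_norm \<Lambda> (c *\<^sub>R z) = \<bar>c\<bar> * slope_norm \<Lambda> z"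
proof -
  obtain \<tau> where \<tau>: "sorts_abs \<tau> z" using sorts_abs_exists by blast
  then have "sorts_abs \<tau> (c *\<^sub>R z)"
    by (auto simp: sorts_abs_def abs_mult mult_left_mono)
  then show ?thesis
    using \<tau> by (simp add: slope_norm_eq abs_mult sum_distrib_left mult.left_commute)
qed

lemma slope_norm_triangle:
  assumes \<Lambda>: "\<Lambda> \<in> decr_pos_vecs"
  shows "slope_norm \<Lambda> (y + z) \<le> slope_norm \<Lambda> y + slope_norm \<Lambda> z"
proof -
  obtain \<tau> where \<tau>: "sorts_abs \<tau> (y + z)" using sorts_abs_exists by blast
  then have b: "bij \<tau>" by (simp add: sorts_abs_def)
  have "slope_norm \<Lambda> (y + z) \<le> (\<Sum>i\<in>UNIV. \<Lambda> $ i * \<bar>y $ \<tau> i\<bar> + \<Lambda> $ i * \<bar>z $ \<tau> i\<bar>)"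
    unfolding slope_norm_eq[OF \<tau>] distrib_left[symmetric]
    using decr_pos_vecsD(1)[OF \<Lambda>] by (intro sum_mono mult_left_mono) (auto simp: less_imp_le)
  also have "\<dots> \<le> slope_norm \<Lambda> y + slope_norm \<Lambda> z"
    using slope_norm_ge[OF \<Lambda> b] by (simp add: sum.distrib add_mono)
  finally show ?thesis .
qed

lemma slope_dual_norm_le_1_iff_partial_sums:
  assumes \<Lambda>: "\<Lambda> \<in> decr_pos_vecs"
  shows "slope_dual_norm \<Lambda> v \<le> 1 \<longleftrightarrow>
    (\<forall>j. (\<Sum>i\<in>{..j}. abs_sorted v $ i) \<le> (\<Sum>i\<in>{..j}. \<Lambda> $ i))"
proof -
  have "0 < (\<Sum>i\<in>{..j}. \<Lambda> $ i)" for j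
    by (intro sum_pos decr_pos_vecsD(1)[OF \<Lambda>]) auto
  then show ?thesis by (simp add: slope_dual_norm_def divide_le_eq_1_pos)
qed

text \<open>
  From left to right, partial sums of \<open>\<bar>v\<bar>\<close> in the order that sorts \<open>z\<close> are at most those of the
  sorted \<open>\<bar>v\<bar>\<close>, hence at most those of \<open>\<Lambda>\<close>, and summation by parts applies. From right to left,
  the test vectors are the sign vectors of \<open>v\<close> supported on its \<open>j\<close> largest entries.
\<close>
lemma slope_dual_norm_le_1_iff:
  assumes \<Lambda>: "\<Lambda> \<in> decr_pos_vecs"
  shows "slope_dual_norm \<Lambda> v \<le> 1 \<longleftrightarrow> (\<forall>z. v \<bullet> z \<le> slope_norm \<Lambda> z)"
  unfolding slope_dual_norm_le_1_iff_partial_sums[OF \<Lambda>]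
proof (intro iffI allI)
  fix z :: "real ^ 'a::{finite,linorder}"
  assume part: "\<forall>j. (\<Sum>i\<in>{..j}. abs_sorted v $ i) \<le> (\<Sum>i\<in>{..j}. \<Lambda> $ i)"
  obtain \<tau> where \<tau>: "sorts_abs \<tau> z" using sorts_abs_exists by blast
  then have b: "bij \<tau>" by (simp add: sorts_abs_def)
  have "v \<bullet> z = (\<Sum>i\<in>UNIV. v $ \<tau> i * z $ \<tau> i)"
    using sum.reindex_bij_betw[OF b, of "\<lambda>i. v $ i * z $ i"] by (simp add: inner_vec_def)
  also have "\<dots> \<le> (\<Sum>i\<in>UNIV. \<bar>v $ \<tau> i\<bar> * \<bar>z $ \<tau> i\<bar>)"
    by (intro sum_mono) (metis abs_ge_self abs_mult)
  also have "\<dots> \<le> (\<Sum>i\<in>UNIV. \<Lambda> $ i * \<bar>z $ \<tau> i\<bar>)"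
  proof (rule sum_mult_mono_if_partial_sums_mono)
    fix j
    have "(\<Sum>i\<in>{..j}. \<bar>v $ \<tau> i\<bar>) = (\<Sum>i\<in>\<tau> ` {..j}. \<bar>v $ i\<bar>)"
      using b by (simp add: sum.reindex bij_def inj_on_def)
    also have "\<dots> \<le> (\<Sum>i\<in>{..j}. abs_sorted v $ i)"
      using b by (intro sum_le_initial_sum_abs_sorted card_image) (auto simp: bij_def inj_on_def)
    finally show "(\<Sum>i\<in>{..j}. \<bar>v $ \<tau> i\<bar>) \<le> (\<Sum>i\<in>{..j}. \<Lambda> $ i)"
      using part order_trans by blast
  qed (use \<tau> in \<open>auto simp: sorts_abs_def\<close>)
  also have "\<dots> = slope_norm \<Lambda> z" using \<tau> by (simp add: slope_norm_eq)
  finally show "v \<bullet> z \<le> slope_norm \<Lambda> z" .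
next
  fix j
  assume le: "\<forall>z. v \<bullet> z \<le> slope_norm \<Lambda> z"
  obtain \<tau> where \<tau>: "sorts_abs \<tau> v" using sorts_abs_exists by blast
  then have b: "bij \<tau>" by (simp add: sorts_abs_def)
  define s where "s x = (if 0 \<le> x then 1 else -1 :: real)" for x :: real
  define z where "z = (\<chi> i. if inv \<tau> i \<le> j then s (v $ i) else 0)"
  have z: "z $ \<tau> i = (if i \<le> j then s (v $ \<tau> i) else 0)" for i
    using b by (simp add: z_def bij_is_inj)
  have abs_s: "\<bar>s x\<bar> = 1" "x * s x = \<bar>x\<bar>" for x by (auto simp: s_def)
  have "sorts_abs \<tau> z"
    using b by (auto simp: sorts_abs_def z abs_s)
  then have "slope_norm \<Lambda> z = (\<Sum>i\<in>{..j}. \<Lambda> $ i)"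
    by (simp add: slope_norm_eq z abs_s if_distrib[of abs] if_distrib[of "\<lambda>x. _ * x"]
        sum.If_cases atMost_def cong: if_cong)
  moreover have "v \<bullet> z = (\<Sum>i\<in>{..j}. abs_sorted v $ i)"
  proof -
    have "v \<bullet> z = (\<Sum>i\<in>UNIV. v $ \<tau> i * z $ \<tau> i)"
      using sum.reindex_bij_betw[OF b, of "\<lambda>i. v $ i * z $ i"] by (simp add: inner_vec_def)
    then show ?thesis
      by (simp add: abs_sorted_eq[OF \<tau>] z abs_s if_distrib[of "\<lambda>x. _ * x"]
          sum.If_cases atMost_def cong: if_cong)
  qed
  ultimately show "(\<Sum>i\<in>{..j}. abs_sorted v $ i) \<le> (\<Sum>i\<in>{..j}. \<Lambda> $ i)"
    using le by metis
qed

section \<open>The Moore-Penrose pseudo-inverse\<close>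

lemma inner_transpose_mult: "(transpose A *v x) \<bullet> y = x \<bullet> (A *v y)"
  for A :: "real ^ 'n ^ 'm"
  using dot_lmul_matrix[of x A y] by simp

lemma generalized_inverse_exists: "\<exists>G :: real ^ 'm ^ 'n. A ** G ** A = A"
  for A :: "real ^ 'n ^ 'm"
proof -
  obtain g where g: "linear g" "\<forall>v\<in>range ((*v) A). A *v g v = v"
    using linear_exists_right_inverse_on[of "(*v) A" UNIV] by auto
  have "A *v (matrix g *v (A *v x)) = A *v x" for x
    using g by (simp add: matrix_works)
  then have "A ** matrix g ** A = A"
    by (simp add: matrix_eq flip: matrix_vector_mul_assoc)
  then show ?thesis by blast
qed

text \<open>
  Whatever generalized inverse \<open>G\<close> of the Gram matrix is taken, \<open>A ** G ** transpose A\<close> is the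
  orthogonal projection onto the column space of \<open>A\<close>: the error \<open>A *v d\<close> it makes on a vector of
  the column space is in the kernel of \<open>transpose A\<close>, hence orthogonal to itself.
\<close>
lemma gram_projection:
  fixes A :: "real ^ 'n ^ 'm"
  assumes G: "(transpose A ** A) ** G ** (transpose A ** A) = transpose A ** A"
  shows "A ** G ** transpose A ** A = A"
    and "transpose (A ** G ** transpose A) = A ** G ** transpose A"
proof -
  define P where "P = A ** G ** transpose A"
  have "P *v (A *v x) = A *v x" for x
  proof -
    define d where "d = G *v ((transpose A ** A) *v x) - x"
    have "transpose A *v (A *v d) = 0"
    proof -
      have "(transpose A ** A) *v (G *v ((transpose A ** A) *v x)) = (transpose A ** A) *v x"
        using G by (simp add: matrix_vector_mul_assoc matrix_mul_assoc)
      then show ?thesis by (simp add: d_def matrix_vector_mult_diff_distrib matrix_vector_mul_assoc matrix_mul_assoc)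
    qed
    then have "(A *v d) \<bullet> (A *v d) = 0"
      using inner_transpose_mult[of A "A *v d" d] by simp
    then have "A *v d = 0" by simp
    then show ?thesis
      by (simp add: P_def d_def matrix_vector_mult_diff_distrib matrix_vector_mul_assoc matrix_mul_assoc)
  qed
  then have PA: "P ** A = A" by (simp add: matrix_eq flip: matrix_vector_mul_assoc)
  then show "A ** G ** transpose A ** A = A" by (simp add: P_def)
  have "transpose A ** transpose P = transpose A"
    using PA by (metis matrix_transpose_mul)
  \<comment> \<open>a matrix of the form \<open>P ** transpose P\<close> is symmetric, hence so is \<open>P\<close>\<close>
  then have "P ** transpose P = P" by (simp add: P_def flip: matrix_mul_assoc)
  then show "transpose (A ** G ** transpose A) = A ** G ** transpose A"
    unfolding P_def[symmetric] by (metis matrix_transpose_mul transpose_transpose)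
qed

text \<open>
  With \<open>G\<close> and \<open>H\<close> generalized inverses of the two Gram matrices, so that \<open>P = A ** G ** transpose A\<close>
  and \<open>Q = transpose A ** H ** A\<close> are the projections onto the column and row space, the
  pseudo-inverse is \<open>transpose A ** H ** A ** G ** transpose A\<close>.
\<close>
lemma is_pinv_exists: "\<exists>B. is_pinv A B"
proof -
  obtain G where G: "(transpose A ** A) ** G ** (transpose A ** A) = transpose A ** A"
    using generalized_inverse_exists by blast
  obtain H where H: "(A ** transpose A) ** H ** (A ** transpose A) = A ** transpose A"
    using generalized_inverse_exists by blast
  define P where "P = A ** G ** transpose A"
  define Q where "Q = transpose A ** H ** A"
  have P: "P ** A = A" "transpose P = P"
    using gram_projection[OF G] by (simp_all add: P_def)
  have Q: "Q ** transpose A = transpose A" "transpose Q = Q"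
    using gram_projection[of "transpose A" H] H by (simp_all add: Q_def)
  have AQ: "A ** Q = A" using Q by (metis matrix_transpose_mul transpose_transpose)
  define B where "B = transpose A ** H ** P"
  have AB: "A ** B = P"
  proof -
    have "A ** B = (A ** Q) ** G ** transpose A" by (simp add: B_def P_def Q_def matrix_mul_assoc)
    then show ?thesis by (simp add: AQ P_def)
  qed
  have BA: "B ** A = Q"
    using P(1) by (simp add: B_def Q_def flip: matrix_mul_assoc)
  have "B ** A ** B = B"
  proof -
    have "Q ** B = (Q ** transpose A) ** H ** P" by (simp add: B_def matrix_mul_assoc)
    then show ?thesis unfolding BA by (simp add: Q(1) B_def)
  qed
  then have "is_pinv A B" by (simp add: is_pinv_def AB BA P Q)
  then show ?thesis by blast
qed

lemma is_pinv_unique: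
  assumes B: "is_pinv A B" and C: "is_pinv A C"
  shows "B = C"
proof -
  have "A ** B = A ** C"
  proof -
    have "A ** B = (A ** C) ** (A ** B)" using C by (simp add: is_pinv_def matrix_mul_assoc)
    also have "\<dots> = transpose (A ** C) ** transpose (A ** B)" using B C by (simp add: is_pinv_def)
    also have "\<dots> = transpose ((A ** B) ** (A ** C))" by (simp only: matrix_transpose_mul)
    also have "\<dots> = A ** C" using B C by (simp add: is_pinv_def matrix_mul_assoc)
    finally show ?thesis .
  qed
  moreover have "B ** A = C ** A"
  proof -
    have "B ** A = (B ** A) ** (C ** A)" using C by (simp add: is_pinv_def flip: matrix_mul_assoc)
    also have "\<dots> = transpose (B ** A) ** transpose (C ** A)" using B C by (simp add: is_pinv_def)
    also have "\<dots> = transpose ((C ** A) ** (B ** A))" by (simp only: matrix_transpose_mul)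
    also have "\<dots> = C ** A" using B C by (simp add: is_pinv_def flip: matrix_mul_assoc)
    finally show ?thesis .
  qed
  ultimately show ?thesis using B C by (metis is_pinv_def matrix_mul_assoc)
qed

lemma is_pinv_pinv: "is_pinv A (pinv A)"
  unfolding pinv_def using is_pinv_exists is_pinv_unique by (metis theI)

lemma pinv_transpose: "pinv (transpose A) = transpose (pinv A)"
proof (rule is_pinv_unique[OF is_pinv_pinv])
  note p = is_pinv_pinv[of A, unfolded is_pinv_def]
  show "is_pinv (transpose A) (transpose (pinv A))"
    unfolding is_pinv_def
    using p by (metis matrix_transpose_mul matrix_mul_assoc)
qed

lemma transpose_col_proj: "transpose (col_proj A) = col_proj A"
  using is_pinv_pinv[of A] by (simp add: col_proj_def is_pinv_def)

lemma col_proj_mult: "col_proj A ** A = A"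
  using is_pinv_pinv[of A] by (simp add: col_proj_def is_pinv_def)

lemma transpose_mult_col_proj: "transpose A ** col_proj A = transpose A"
  by (metis col_proj_mult matrix_transpose_mul transpose_col_proj)

lemma pinv_transpose_mult_transpose: "pinv (transpose A) ** transpose A = col_proj A"
  by (metis col_proj_def matrix_transpose_mul pinv_transpose transpose_col_proj)

lemma mem_col_space_iff: "y \<in> col_space A \<longleftrightarrow> (\<exists>x. y = A *v x)"
  for A :: "real ^ 'n ^ 'm"
proof
  assume y: "y \<in> col_space A"
  have "columns A \<subseteq> range ((*v) A)"
    by (auto simp: columns_def simp flip: matrix_vector_mult_basis)
  moreover have "subspace (range ((*v) A))"
    by (intro linear_subspace_image) auto
  ultimately have "span (columns A) \<subseteq> range ((*v) A)" by (rule span_minimal)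
  then show "\<exists>x. y = A *v x" using y by (auto simp: col_space_def)
qed (auto simp: col_space_def matrix_vector_mult_in_columnspace)

lemma mem_col_space_iff_pinv: "y \<in> col_space A \<longleftrightarrow> A *v (pinv A *v y) = y"
  for A :: "real ^ 'n ^ 'm"
proof
  assume "y \<in> col_space A"
  then obtain x where "y = A *v x" by (auto simp: mem_col_space_iff)
  then show "A *v (pinv A *v y) = y"
    using is_pinv_pinv[of A] by (simp add: matrix_vector_mul_assoc matrix_mul_assoc is_pinv_def)
qed (metis mem_col_space_iff)

section \<open>Vectors with a given pattern\<close>

text \<open>
  What the proofs need to know about a pattern: its absolute values are natural numbers that fill
  \<open>{1..K}\<close> without a gap. Level 0, that of the zero entries, may or may not occur.
\<close>
definition pattern_levels :: "real ^ 'p \<Rightarrow> nat \<Rightarrow> ('p \<Rightarrow> nat) \<Rightarrow> bool" where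
  "pattern_levels M K m \<longleftrightarrow>
     (\<forall>i. \<bar>M $ i\<bar> = real (m i)) \<and> range m \<subseteq> {..K} \<and> {1..K} \<subseteq> range m"

text \<open>
  Column \<open>j\<close> of a pattern matrix collects the entries of level \<open>CARD('k) + 1 - pos j\<close>, so the
  value that \<open>s\<close> puts on level \<open>q\<close> is its \<open>q\<close>-th entry counted from the end. The sum has one
  term for \<open>q\<close> in \<open>{1..CARD('k)}\<close> and is empty for \<open>q = 0\<close>, which handles zero entries uniformly.
\<close>
definition level_value :: "real ^ 'k::{finite,linorder} \<Rightarrow> nat \<Rightarrow> real" where
  "level_value s q = (\<Sum>j | pos j + q = CARD('k) + 1. s $ j)"

lemma level_value_0: "level_value s 0 = 0"
proof -
  have "pos j \<noteq> CARD('a) + 1" for j :: 'a using pos_bounds(2)[of j] by simp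
  then show ?thesis by (simp add: level_value_def)
qed

lemma level_value_eq:
  fixes s :: "real ^ 'k::{finite,linorder}"
  assumes "pos j + q = CARD('k) + 1"
  shows "level_value s q = s $ j"
proof -
  have "{j'. pos j' + q = CARD('k) + 1} = {j}"
    using assms by (auto simp: pos_eq_iff[symmetric])
  then show ?thesis by (simp add: level_value_def)
qed

lemma level_index_exists:
  assumes "1 \<le> q" "q \<le> CARD('k)"
  obtains j :: "'k::{finite,linorder}" where "pos j + q = CARD('k) + 1"
proof -
  have "CARD('k) + 1 - q \<in> range (pos :: 'k \<Rightarrow> nat)"
    using assms by (auto simp: range_pos)
  then obtain j :: 'k where "pos j = CARD('k) + 1 - q" by auto
  with that assms show ?thesis by (metis add.commute le_add_diff_inverse le_add1 le_trans)
qed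

lemma level_value_pos:
  fixes s :: "real ^ 'k::{finite,linorder}"
  assumes "s \<in> decr_pos_vecs" "1 \<le> q" "q \<le> CARD('k)"
  shows "0 < level_value s q"
proof -
  obtain j :: 'k where "pos j + q = CARD('k) + 1" using level_index_exists assms(2,3) .
  then show ?thesis using level_value_eq[of j q s] decr_pos_vecsD(1)[OF assms(1)] by simp
qed

lemma level_value_strict_mono:
  fixes s :: "real ^ 'k::{finite,linorder}"
  assumes s: "s \<in> decr_pos_vecs" and q: "q < q'" "q' \<le> CARD('k)"
  shows "level_value s q < level_value s q'"
proof (cases "q = 0")
  case True
  then show ?thesis using level_value_pos[OF s, of q'] q by (simp add: level_value_0)
next
  case False
  obtain j :: 'k where j: "pos j + q = CARD('k) + 1" 
    by (rule level_index_exists[of q]) (use False q in auto)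
  obtain j' :: 'k where j': "pos j' + q' = CARD('k) + 1"
    by (rule level_index_exists[of q']) (use False q in auto)
  have "j' < j" using j j' q by (simp add: pos_less_iff[symmetric])
  then show ?thesis
    using decr_pos_vecsD(3)[OF s] by (simp add: level_value_eq[OF j] level_value_eq[OF j'])
qed

lemma level_value_mono:
  fixes s :: "real ^ 'k::{finite,linorder}"
  assumes "s \<in> decr_pos_vecs" "q \<le> q'" "q' \<le> CARD('k)"
  shows "level_value s q \<le> level_value s q'"
  using level_value_strict_mono[of s q q'] assms by (cases "q = q'") auto

lemma pattern_matrix_mult:
  fixes s :: "real ^ 'k::{finite,linorder}"
  assumes "\<bar>M $ i\<bar> = real q"
  shows "(pattern_matrix M *v s) $ i = sgn (M $ i) * level_value s q"
proof -
  have "\<bar>M $ i\<bar> = real CARD('k) + 1 - real (pos j) \<longleftrightarrow> pos j + q = CARD('k) + 1" for j :: 'k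
    using assms by linarith
  then have "(pattern_matrix M *v s) $ i =
      (\<Sum>j\<in>UNIV. sgn (M $ i) * (if pos j + q = CARD('k) + 1 then s $ j else 0))"
    by (auto simp: matrix_vector_mult_def pattern_matrix_def intro!: sum.cong)
  then show ?thesis
    by (simp add: level_value_def sum.If_cases flip: sum_distrib_left)
qed

lemma abs_pattern_matrix_mult:
  fixes s :: "real ^ 'k::{finite,linorder}"
  assumes s: "s \<in> decr_pos_vecs" and m: "pattern_levels M CARD('k) m"
  shows "\<bar>(pattern_matrix M *v s) $ i\<bar> = level_value s (m i)"
    and "sgn ((pattern_matrix M *v s) $ i) = sgn (M $ i)"
proof -
  have q: "\<bar>M $ i\<bar> = real (m i)" "m i \<le> CARD('k)" using m by (auto simp: pattern_levels_def)
  have eq: "(pattern_matrix M *v s) $ i = sgn (M $ i) * level_value s (m i)"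
    by (rule pattern_matrix_mult[OF q(1)])
  have "\<bar>(pattern_matrix M *v s) $ i\<bar> = level_value s (m i) \<and>
    sgn ((pattern_matrix M *v s) $ i) = sgn (M $ i)"
  proof (cases "m i = 0")
    case True
    then show ?thesis using q(1) eq by (simp add: level_value_0)
  next
    case False
    then have "0 < level_value s (m i)" using q(2) level_value_pos[OF s, of "m i"] by simp
    moreover have "M $ i \<noteq> 0" using False q(1) by auto
    ultimately show ?thesis using eq by (simp add: abs_mult sgn_mult abs_sgn_eq)
  qed
  then show "\<bar>(pattern_matrix M *v s) $ i\<bar> = level_value s (m i)"
    and "sgn ((pattern_matrix M *v s) $ i) = sgn (M $ i)" by auto
qed

lemma abs_rank_eq_0: "b $ i = 0 \<Longrightarrow> abs_rank b i = 0"
  by (auto simp: abs_rank_def)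

lemma abs_rank_strict_mono:
  assumes "\<bar>b $ i\<bar> < \<bar>b $ j\<bar>"
  shows "abs_rank b i < abs_rank b j"
proof -
  define S where "S i = {v \<in> range (\<lambda>j. \<bar>b $ j\<bar>). v \<noteq> 0 \<and> v \<le> \<bar>b $ i\<bar>}" for i
  have "\<bar>b $ j\<bar> \<in> S j" "\<bar>b $ j\<bar> \<notin> S i" "S i \<subseteq> S j" using assms by (auto simp: S_def)
  then have "S i \<subset> S j" by blast
  moreover have "finite (S j)" by (simp add: S_def)
  ultimately show ?thesis by (simp add: abs_rank_def psubset_card_mono flip: S_def)
qed

lemma abs_rank_less_iff: "abs_rank b i < abs_rank b j \<longleftrightarrow> \<bar>b $ i\<bar> < \<bar>b $ j\<bar>"
proof
  assume less: "abs_rank b i < abs_rank b j"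
  show "\<bar>b $ i\<bar> < \<bar>b $ j\<bar>"
  proof (rule ccontr)
    assume "\<not> \<bar>b $ i\<bar> < \<bar>b $ j\<bar>"
    then have "abs_rank b j \<le> abs_rank b i"
      unfolding abs_rank_def by (intro card_mono) auto
    with less show False by simp
  qed
qed (rule abs_rank_strict_mono)

lemma abs_patt: "\<bar>patt b $ i\<bar> = real (abs_rank b i)"
  by (cases "b $ i = 0") (auto simp: patt_def abs_mult abs_sgn_eq abs_rank_eq_0)

lemma abs_rank_pos_iff: "0 < abs_rank b i \<longleftrightarrow> b $ i \<noteq> 0"
proof
  assume "b $ i \<noteq> 0"
  then have "\<bar>b $ i\<bar> \<in> {v \<in> range (\<lambda>j. \<bar>b $ j\<bar>). v \<noteq> 0 \<and> v \<le> \<bar>b $ i\<bar>}" by auto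
  then show "0 < abs_rank b i" unfolding abs_rank_def by (subst card_gt_0_iff) auto
qed (use abs_rank_eq_0 in force)

lemma sgn_patt: "sgn (patt b $ i) = sgn (b $ i)"
  using abs_rank_pos_iff[of b i] by (cases "b $ i = 0") (auto simp: patt_def sgn_mult)

text \<open>
  The rank function is injective on the set \<open>V\<close> of nonzero absolute values, with values in
  \<open>{1..card V}\<close>; by counting it is onto, so there are no gaps and the largest rank is \<open>card V\<close>.
\<close>
lemma pattern_levels_patt:
  assumes nz: "patt b \<noteq> 0" and K: "real K = infnorm (patt b)"
  shows "pattern_levels (patt b) K (abs_rank b)"
proof -
  define V where "V = {v \<in> range (\<lambda>j. \<bar>b $ j\<bar>). v \<noteq> 0}"
  define r where "r v = card {v' \<in> V. v' \<le> v}" for v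
  have fin: "finite V" by (simp add: V_def)
  have rank: "abs_rank b i = r \<bar>b $ i\<bar>" for i
    by (auto simp: abs_rank_def r_def V_def intro!: arg_cong[where f = card])
  have "r v < r w" if "v \<in> V" "w \<in> V" "v < w" for v w
  proof -
    have "w \<in> {v' \<in> V. v' \<le> w}" "w \<notin> {v' \<in> V. v' \<le> v}" "{v' \<in> V. v' \<le> v} \<subseteq> {v' \<in> V. v' \<le> w}"
      using that by auto
    then have "{v' \<in> V. v' \<le> v} \<subset> {v' \<in> V. v' \<le> w}" by blast
    then show ?thesis unfolding r_def using fin by (intro psubset_card_mono) auto
  qed
  then have inj: "inj_on r V" by (metis inj_onI linorder_less_linear order_less_irrefl)
  have le: "r v \<le> card V" for v unfolding r_def by (intro card_mono fin) auto
  have "1 \<le> r v" if "v \<in> V" for v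
  proof -
    have "v \<in> {v' \<in> V. v' \<le> v}" using that by simp
    then have "{v' \<in> V. v' \<le> v} \<noteq> {}" by blast
    then show ?thesis unfolding r_def using fin by (simp add: Suc_leI card_gt_0_iff)
  qed
  then have "r ` V = {1..card V}"
    using le inj by (intro card_subset_eq) (auto simp: card_image)
  moreover have "r ` V \<subseteq> range (abs_rank b)"
    by (auto simp: V_def rank)
  ultimately have sur: "{1..card V} \<subseteq> range (abs_rank b)" by simp
  have "\<exists>i. b $ i \<noteq> 0" 
  proof (rule ccontr)
    assume "\<not> ?thesis"
    then have "patt b = 0" by (simp add: patt_def vec_eq_iff)
    with nz show False by contradiction
  qed
  then have "V \<noteq> {}" by (auto simp: V_def)
  then have "1 \<le> card V" using fin by (simp add: Suc_leI card_gt_0_iff)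
  then obtain i where "abs_rank b i = card V" using sur by fastforce
  then have "real (card V) \<le> infnorm (patt b)"
    using component_le_infnorm_cart[of "patt b" i] by (simp add: abs_patt)
  moreover have "infnorm (patt b) \<le> real (card V)"
    unfolding infnorm_cart using le by (intro cSup_least) (auto simp: abs_patt rank)
  ultimately have "K = card V" using K by simp
  then show ?thesis
    using sur le by (auto simp: pattern_levels_def abs_patt rank)
qed

lemma pattern_levels_exists:
  assumes "M \<in> slope_patterns" "M \<noteq> 0" "real K = infnorm M"
  obtains m where "pattern_levels M K m"
  using assms pattern_levels_patt unfolding slope_patterns_def by blast

text \<open>
  Entries of \<open>b\<close> with the same rank have the same absolute value, so the coefficient of a column
  can be read off from any entry \<open>a q\<close> of the level \<open>q\<close> of that column.
\<close>
lemma patt_eq_imp_pattern_matrix_mult: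
  assumes m: "pattern_levels M CARD('k) m" and b: "patt b = M"
  shows "\<exists>s :: real ^ 'k::{finite,linorder}. s \<in> decr_pos_vecs \<and> b = pattern_matrix M *v s"
proof -
  have rank: "abs_rank b i = m i" for i
    using m abs_patt[of b i] b by (simp add: pattern_levels_def)
  define a where "a q = (SOME i. m i = q)" for q
  have a: "m (a q) = q" if "q \<in> {1..CARD('k)}" for q
  proof -
    have "\<exists>i. m i = q" using m that unfolding pattern_levels_def by blast
    then show ?thesis unfolding a_def by (rule someI_ex)
  qed
  define s :: "real ^ 'k::{finite,linorder}" where "s = (\<chi> j. \<bar>b $ a (CARD('k) + 1 - pos j)\<bar>)"
  have range: "CARD('k) + 1 - pos j \<in> {1..CARD('k)}" for j :: 'k
    using pos_bounds[of j] by auto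
  have "s \<in> decr_pos_vecs"
    unfolding decr_pos_vecs_def
  proof (intro CollectI conjI allI impI)
    fix i j :: 'k assume "i < j"
    then have "CARD('k) + 1 - pos j < CARD('k) + 1 - pos i"
      using pos_bounds[of j] pos_less_iff[of i j] by linarith
    then show "s $ j < s $ i"
      unfolding s_def vec_lambda_beta abs_rank_less_iff[symmetric] rank a[OF range] .
  next
    fix j :: 'k
    show "0 < s $ j"
      unfolding s_def vec_lambda_beta zero_less_abs_iff abs_rank_pos_iff[symmetric] rank a[OF range]
      using range[of j] by auto
  qed
  moreover have "b $ i = (pattern_matrix M *v s) $ i" for i
  proof (cases "b $ i = 0")
    case True
    then have "M $ i = 0" using sgn_patt[of b i] b by (simp add: sgn_zero_iff)
    then show ?thesis using True by (simp add: pattern_matrix_mult[of M i 0])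
  next
    case False
    have mi: "1 \<le> m i" "m i \<le> CARD('k)"
      using m False abs_rank_pos_iff[of b i] by (auto simp: pattern_levels_def rank)
    then obtain j :: 'k where j: "pos j + m i = CARD('k) + 1" using level_index_exists by blast
    then have "CARD('k) + 1 - pos j = m i" by simp
    then have "s $ j = \<bar>b $ a (m i)\<bar>" by (simp add: s_def)
    also have "\<dots> = \<bar>b $ i\<bar>"
      using abs_rank_less_iff[of b "a (m i)" i] abs_rank_less_iff[of b i "a (m i)"] a[of "m i"] mi
      by (simp add: rank)
    finally have "level_value s (m i) = \<bar>b $ i\<bar>" using level_value_eq[OF j] by simp
    moreover have "\<bar>M $ i\<bar> = real (m i)" using m by (simp add: pattern_levels_def)
    ultimately show ?thesis
      using sgn_patt[of b i] b by (simp add: pattern_matrix_mult sgn_mult_abs)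
  qed
  ultimately show ?thesis by (auto simp: vec_eq_iff)
qed

text \<open>
  Because every level in \<open>{1..m i}\<close> is attained, the nonzero absolute values up to that of entry
  \<open>i\<close> are exactly the values of these levels, and there are \<open>m i\<close> of them.
\<close>
lemma patt_pattern_matrix_mult:
  fixes s :: "real ^ 'k::{finite,linorder}"
  assumes s: "s \<in> decr_pos_vecs" and m: "pattern_levels M CARD('k) m"
  shows "patt (pattern_matrix M *v s) = M"
proof -
  let ?b = "pattern_matrix M *v s"
  note ab = abs_pattern_matrix_mult[OF s m]
  have le: "m i \<le> CARD('k)" for i using m by (auto simp: pattern_levels_def)
  have sm: "level_value s q < level_value s q' \<longleftrightarrow> q < q'" if "q \<le> CARD('k)" "q' \<le> CARD('k)" for q q'
    using level_value_strict_mono[OF s, of q q'] level_value_mono[OF s, of q' q] that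
    by (cases "q < q'") auto
  have "abs_rank ?b i = m i" for i
  proof -
    have "{v \<in> range (\<lambda>j. \<bar>?b $ j\<bar>). v \<noteq> 0 \<and> v \<le> \<bar>?b $ i\<bar>} = level_value s ` {1..m i}"
    proof (intro set_eqI iffI)
      fix v assume "v \<in> {v \<in> range (\<lambda>j. \<bar>?b $ j\<bar>). v \<noteq> 0 \<and> v \<le> \<bar>?b $ i\<bar>}"
      then obtain j where j: "v = level_value s (m j)" "v \<noteq> 0"
        "level_value s (m j) \<le> level_value s (m i)" by (auto simp: ab)
      have "m j \<noteq> 0" using j by (metis level_value_0)
      moreover have "m j \<le> m i" using j(3) sm[of "m i" "m j"] le by (simp add: not_less[symmetric])
      ultimately show "v \<in> level_value s ` {1..m i}" using j(1) by auto
    next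
      fix v assume "v \<in> level_value s ` {1..m i}"
      then obtain q where q: "v = level_value s q" "1 \<le> q" "q \<le> m i" by auto
      then have qK: "q \<le> CARD('k)" using le[of i] by simp
      have "q \<in> {1..CARD('k)}" using q(2) qK by simp
      moreover have "{1..CARD('k)} \<subseteq> range m" using m by (simp add: pattern_levels_def)
      ultimately obtain j where j: "q = m j" by blast
      have "0 < v" using level_value_pos[OF s q(2) qK] q(1) by simp
      moreover have "v \<le> level_value s (m i)" using level_value_mono[OF s q(3) le] q(1) by simp
      ultimately show "v \<in> {v \<in> range (\<lambda>j. \<bar>?b $ j\<bar>). v \<noteq> 0 \<and> v \<le> \<bar>?b $ i\<bar>}"
        using q(1) j by (auto simp: ab)
    qed
    moreover have "inj_on (level_value s) {1..m i}"
    proof (rule inj_onI)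
      fix q q' assume "q \<in> {1..m i}" "q' \<in> {1..m i}" "level_value s q = level_value s q'"
      then show "q = q'" using sm[of q q'] sm[of q' q] le[of i] by force
    qed
    ultimately show ?thesis unfolding abs_rank_def by (simp add: card_image)
  qed
  then show ?thesis
    using m by (simp add: patt_def vec_eq_iff ab pattern_levels_def sgn_mult_abs flip: of_nat_eq_iff)
      (metis mult.commute sgn_mult_abs)
qed

lemma patt_eq_iff:
  assumes m: "pattern_levels M CARD('k) m"
  shows "patt b = M \<longleftrightarrow> (\<exists>s :: real ^ 'k::{finite,linorder} \<in> decr_pos_vecs. b = pattern_matrix M *v s)"
proof
  assume "patt b = M"
  from patt_eq_imp_pattern_matrix_mult[OF m this]
  show "\<exists>s :: real ^ 'k::{finite,linorder} \<in> decr_pos_vecs. b = pattern_matrix M *v s" by (auto simp: Bex_def)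
next
  assume "\<exists>s :: real ^ 'k::{finite,linorder} \<in> decr_pos_vecs. b = pattern_matrix M *v s"
  then show "patt b = M" using patt_pattern_matrix_mult[OF _ m] by auto
qed

lemma pattern_matrix_mult_levels:
  assumes m: "pattern_levels M CARD('k) m"
  obtains s :: "real ^ 'k::{finite,linorder}" where "s \<in> decr_pos_vecs" "pattern_matrix M *v s = M"
proof
  let ?s = "(\<chi> j. real (CARD('k) + 1 - pos j)) :: real ^ 'k::{finite,linorder}"
  show s: "?s \<in> decr_pos_vecs"
    unfolding decr_pos_vecs_def
  proof (intro CollectI conjI allI impI)
    fix i j :: 'k assume "i < j"
    then show "?s $ j < ?s $ i"
      using pos_less_iff[of i j] pos_bounds[of j] pos_bounds[of i] by simp
  next
    fix j :: 'k show "0 < ?s $ j" using pos_bounds[of j] by simp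
  qed
  have "(pattern_matrix M *v ?s) $ i = M $ i" for i
  proof -
    have mi: "\<bar>M $ i\<bar> = real (m i)" "m i \<le> CARD('k)" using m by (auto simp: pattern_levels_def)
    have "level_value ?s (m i) = real (m i)"
    proof (cases "m i = 0")
      case False
      obtain j :: 'k where j: "pos j + m i = CARD('k) + 1"
        by (rule level_index_exists[of "m i"]) (use False mi(2) in auto)
      then show ?thesis using level_value_eq[OF j, of ?s] by simp
    qed (simp add: level_value_0)
    then show ?thesis using mi(1) by (metis pattern_matrix_mult[OF mi(1)] sgn_mult_abs)
  qed
  then show "pattern_matrix M *v ?s = M" by (simp add: vec_eq_iff)
qed

text \<open>
  A permutation that sorts \<open>M\<close> also sorts every vector \<open>pattern_matrix M *v s\<close> with \<open>s\<close> in the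
  cone; this is why the SLOPE norm is linear there.
\<close>
lemma slope_norm_pattern_matrix_mult:
  fixes s :: "real ^ 'k::{finite,linorder}"
  assumes s: "s \<in> decr_pos_vecs" and m: "pattern_levels M CARD('k) m"
  shows "slope_norm \<Lambda> (pattern_matrix M *v s) = \<Lambda>_tilde \<Lambda> M \<bullet> s"
proof -
  obtain \<rho> where \<rho>: "sorts_abs \<rho> M" using sorts_abs_exists by blast
  note ab = abs_pattern_matrix_mult[OF s m]
  have m': "\<bar>M $ i\<bar> = real (m i)" "m i \<le> CARD('k)" for i using m by (auto simp: pattern_levels_def)
  have "sorts_abs \<rho> (pattern_matrix M *v s)"
    using \<rho> by (auto simp: sorts_abs_def ab m' intro!: level_value_mono[OF s])
  then have "slope_norm \<Lambda> (pattern_matrix M *v s) = (\<Sum>i\<in>UNIV. \<Lambda> $ i * level_value s (m (\<rho> i)))"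
    by (simp add: slope_norm_eq ab)
  also have "\<dots> = \<Lambda> \<bullet> (pattern_matrix (abs_sorted M) *v s)"
    unfolding inner_vec_def
  proof (rule sum.cong)
    fix i
    have e: "abs_sorted M $ i = real (m (\<rho> i))" by (simp add: abs_sorted_eq[OF \<rho>] m')
    then have "\<bar>abs_sorted M $ i\<bar> = real (m (\<rho> i))" by simp
    from pattern_matrix_mult[OF this, of s]
    show "\<Lambda> $ i * level_value s (m (\<rho> i)) =
        \<Lambda> $ i \<bullet> (pattern_matrix (abs_sorted M) *v s) $ i"
      by (cases "m (\<rho> i) = 0") (simp_all add: e level_value_0)
  qed simp
  also have "\<dots> = \<Lambda>_tilde \<Lambda> M \<bullet> s"
    unfolding \<Lambda>_tilde_def by (rule inner_transpose_mult[symmetric])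
  finally show ?thesis .
qed

section \<open>Subdifferential and optimality condition\<close>

lemma open_decr_pos_vecs: "open (decr_pos_vecs :: (real ^ 'k::{finite,linorder}) set)"
proof -
  have "(decr_pos_vecs :: (real ^ 'k::{finite,linorder}) set) =
      (\<Inter>i. {\<kappa>. 0 < \<kappa> $ i}) \<inter> (\<Inter>(i, j)\<in>{(i, j). i < j}. {\<kappa>. \<kappa> $ j < \<kappa> $ i})"
    by (auto simp: decr_pos_vecs_def)
  also have "open \<dots>"
    by (intro open_Int open_INT finite ballI) (auto intro!: open_Collect_less continuous_intros)
  finally show ?thesis .
qed

lemma mem_subdifferential_slope_norm_iff:
  assumes \<Lambda>: "\<Lambda> \<in> decr_pos_vecs"
  shows "v \<in> subdifferential (slope_norm \<Lambda>) b \<longleftrightarrow>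
    slope_dual_norm \<Lambda> v \<le> 1 \<and> v \<bullet> b = slope_norm \<Lambda> b"
  unfolding slope_dual_norm_le_1_iff[OF \<Lambda>]
proof
  assume "v \<in> subdifferential (slope_norm \<Lambda>) b"
  then have sub: "slope_norm \<Lambda> b + v \<bullet> (z - b) \<le> slope_norm \<Lambda> z" for z
    by (auto simp: subdifferential_def)
  have "v \<bullet> b = slope_norm \<Lambda> b"
    using sub[of "2 *\<^sub>R b"] sub[of "0 *\<^sub>R b"] unfolding slope_norm_scale
    by (simp add: inner_diff_right)
  then show "(\<forall>z. v \<bullet> z \<le> slope_norm \<Lambda> z) \<and> v \<bullet> b = slope_norm \<Lambda> b"
    using sub by (simp add: inner_diff_right)
qed (auto simp: subdifferential_def inner_diff_right)

text \<open>
  A subgradient \<open>v\<close> lies in the dual ball, so \<open>t \<mapsto> \<Lambda>M \<bullet> t - v \<bullet> (U *v t)\<close>, with \<open>U\<close> and \<open>\<Lambda>M\<close>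
  the reduced matrix and weights, is a nonnegative linear functional on the cone that vanishes at
  \<open>s\<close>. Since the cone is open, the functional is zero.
\<close>
lemma subdifferential_slope_norm_pattern:
  fixes s :: "real ^ 'k::{finite,linorder}"
  assumes \<Lambda>: "\<Lambda> \<in> decr_pos_vecs" and s: "s \<in> decr_pos_vecs"
    and m: "pattern_levels M CARD('k) m"
  shows "v \<in> subdifferential (slope_norm \<Lambda>) (pattern_matrix M *v s) \<longleftrightarrow>
    slope_dual_norm \<Lambda> v \<le> 1 \<and>
    transpose (pattern_matrix M :: real ^ 'k::{finite,linorder} ^ _) *v v = \<Lambda>_tilde \<Lambda> M"
proof -
  let ?U = "pattern_matrix M :: real ^ 'k::{finite,linorder} ^ _"
  let ?w = "\<Lambda>_tilde \<Lambda> M - transpose ?U *v v"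
  have gap: "?w \<bullet> t = slope_norm \<Lambda> (?U *v t) - v \<bullet> (?U *v t)" if "t \<in> decr_pos_vecs" for t
    using slope_norm_pattern_matrix_mult[OF that m, of \<Lambda>]
    by (simp only: inner_diff_left inner_transpose_mult)
  have "?w = 0"
    if dual: "\<And>z. v \<bullet> z \<le> slope_norm \<Lambda> z" and eq: "v \<bullet> (?U *v s) = slope_norm \<Lambda> (?U *v s)"
  proof -
    obtain e where e: "0 < e" "ball s e \<subseteq> decr_pos_vecs"
      using open_decr_pos_vecs s open_contains_ball by blast
    define \<tau> where "\<tau> = e / (2 * (norm ?w + 1))"
    have \<tau>: "0 < \<tau>" using e(1) by (simp add: \<tau>_def add_nonneg_pos)
    have "\<tau> * norm ?w < e"
    proof -
      have "x < 2 * (x + 1)" if "0 \<le> x" for x :: real using that by simp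
      from this[OF norm_ge_zero[of ?w]]
      have "e * norm ?w < e * (2 * (norm ?w + 1))" using e(1) by (intro mult_strict_left_mono)
      moreover have "0 < 2 * (norm ?w + 1)" by (simp add: add_nonneg_pos)
      ultimately show ?thesis by (simp add: \<tau>_def divide_less_eq)
    qed
    then have "s - \<tau> *\<^sub>R ?w \<in> ball s e" using \<tau> by (simp add: dist_norm)
    then have cone: "s - \<tau> *\<^sub>R ?w \<in> decr_pos_vecs" using e(2) by blast
    have "0 \<le> ?w \<bullet> (s - \<tau> *\<^sub>R ?w)"
      unfolding gap[OF cone] using dual by (simp only: diff_ge_0_iff_ge)
    moreover have "?w \<bullet> s = 0" using gap[OF s] eq by simp
    ultimately have "\<tau> * (?w \<bullet> ?w) \<le> 0" by (simp only: inner_diff_right inner_scaleR_right)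
    then have "?w \<bullet> ?w \<le> 0" using \<tau> by (simp add: mult_le_0_iff)
    then show ?thesis by (metis inner_ge_zero inner_eq_zero_iff order_antisym)
  qed
  moreover have "v \<bullet> (?U *v s) = slope_norm \<Lambda> (?U *v s)" if "?w = 0"
    using gap[OF s] that by simp
  ultimately show ?thesis
    unfolding mem_subdifferential_slope_norm_iff[OF \<Lambda>] slope_dual_norm_le_1_iff[OF \<Lambda>] by auto
qed

text \<open>
  Let \<open>D\<close> be \<open>\<alpha>\<close> times the slack of the subgradient inequality at \<open>b + h\<close>, and \<open>c\<close> the square of
  \<open>norm (X *v h)\<close>. Moving from \<open>b\<close> to \<open>b + h\<close> changes the penalized loss by \<open>D + c / 2\<close>, which is
  nonnegative if \<open>D\<close> is. Conversely, convexity of the norm shows that moving to \<open>b + t *\<^sub>R h\<close> with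
  \<open>t\<close> in \<open>{0..1}\<close> changes the loss by at most \<open>t * D + t\<^sup>2 * c / 2\<close>, which would be negative for
  small positive \<open>t\<close> if \<open>D\<close> were.
\<close>
lemma slope_minimizers_iff:
  fixes X :: "real ^ 'p::{finite,linorder} ^ 'n"
  assumes \<Lambda>: "\<Lambda> \<in> decr_pos_vecs" and \<alpha>: "0 < \<alpha>"
  shows "b \<in> slope_minimizers X \<alpha> \<Lambda> Y \<longleftrightarrow>
    (1 / \<alpha>) *\<^sub>R (transpose X *v (Y - X *v b)) \<in> subdifferential (slope_norm \<Lambda>) b"
proof -
  define g where "g = transpose X *v (Y - X *v b)"
  let ?f = "\<lambda>b. 1/2 * (norm (Y - X *v b))\<^sup>2 + \<alpha> * slope_norm \<Lambda> b"
  have diff: "?f (b + h) - ?f b =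
      1/2 * (norm (X *v h))\<^sup>2 - g \<bullet> h + \<alpha> * (slope_norm \<Lambda> (b + h) - slope_norm \<Lambda> b)" for h
  proof -
    have "Y - X *v (b + h) = (Y - X *v b) - X *v h"
      by (simp add: matrix_vector_right_distrib)
    moreover have "g \<bullet> h = (Y - X *v b) \<bullet> (X *v h)"
      unfolding g_def by (rule inner_transpose_mult)
    ultimately show ?thesis
      by (simp add: power2_norm_eq_inner inner_diff_left inner_diff_right inner_commute algebra_simps)
  qed
  have min: "b \<in> slope_minimizers X \<alpha> \<Lambda> Y \<longleftrightarrow> (\<forall>h. 0 \<le> ?f (b + h) - ?f b)"
    unfolding slope_minimizers_def is_arg_min_def
    by (simp add: not_less) (metis add_diff_cancel_left' add.commute diff_add_cancel)
  have sub: "(1 / \<alpha>) *\<^sub>R g \<in> subdifferential (slope_norm \<Lambda>) b \<longleftrightarrow>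
      (\<forall>h. g \<bullet> h \<le> \<alpha> * (slope_norm \<Lambda> (b + h) - slope_norm \<Lambda> b))" (is "?L \<longleftrightarrow> ?R")
  proof -
    have "?L \<longleftrightarrow> (\<forall>h. slope_norm \<Lambda> b + (1 / \<alpha>) * (g \<bullet> h) \<le> slope_norm \<Lambda> (b + h))"
      unfolding subdifferential_def
      by simp (metis add_diff_cancel_left' add.commute diff_add_cancel)
    also have "\<dots> \<longleftrightarrow> ?R" using \<alpha> by (simp add: field_simps)
    finally show ?thesis .
  qed
  have "0 \<le> ?f (b + h) - ?f b" if "?R" for h
  proof -
    have "0 \<le> 1/2 * (norm (X *v h))\<^sup>2" by simp
    with that[rule_format, of h] show ?thesis unfolding diff by linarith
  qed
  moreover have "g \<bullet> h \<le> \<alpha> * (slope_norm \<Lambda> (b + h) - slope_norm \<Lambda> b)"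
    if opt: "\<forall>h. 0 \<le> ?f (b + h) - ?f b" for h
  proof (rule ccontr)
    define D where "D = \<alpha> * (slope_norm \<Lambda> (b + h) - slope_norm \<Lambda> b) - g \<bullet> h"
    define c where "c = (norm (X *v h))\<^sup>2"
    assume "\<not> ?thesis"
    then have D: "D < 0" by (simp add: D_def)
    have c: "0 \<le> c" by (simp add: c_def)
    have bound: "0 \<le> t * (1/2 * t * c + D)" if t: "0 < t" "t \<le> 1" for t
    proof -
      have "b + t *\<^sub>R h = (1 - t) *\<^sub>R b + t *\<^sub>R (b + h)" by (simp add: algebra_simps)
      then have "slope_norm \<Lambda> (b + t *\<^sub>R h) \<le> (1 - t) * slope_norm \<Lambda> b + t * slope_norm \<Lambda> (b + h)"
        using slope_norm_triangle[OF \<Lambda>, of "(1 - t) *\<^sub>R b" "t *\<^sub>R (b + h)"] t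
        unfolding slope_norm_scale by simp
      then have "slope_norm \<Lambda> (b + t *\<^sub>R h) - slope_norm \<Lambda> b \<le> t * (slope_norm \<Lambda> (b + h) - slope_norm \<Lambda> b)"
        by (simp add: algebra_simps)
      from mult_left_mono[OF this less_imp_le[OF \<alpha>]]
      have "0 \<le> 1/2 * (norm (X *v (t *\<^sub>R h)))\<^sup>2 - t * (g \<bullet> h)
          + \<alpha> * (t * (slope_norm \<Lambda> (b + h) - slope_norm \<Lambda> b))"
        using opt[rule_format, of "t *\<^sub>R h"] unfolding diff by simp
      then show ?thesis
        by (simp add: D_def c_def matrix_vector_mult_scaleR power_mult_distrib algebra_simps power2_eq_square)
    qed
    \<comment> \<open>small enough for \<open>t * c \<le> - D\<close>, where the quadratic term is at most half of \<open>- t * D\<close>\<close>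
    define t where "t = min 1 (- D / (c + 1))"
    have t: "0 < t" "t \<le> 1" using D c by (auto simp: t_def divide_neg_pos)
    have "t * c \<le> (- D / (c + 1)) * c" using c by (intro mult_right_mono) (auto simp: t_def)
    also have "\<dots> \<le> - D"
    proof -
      have "(- D) * (c / (c + 1)) \<le> (- D) * 1" using D c by (intro mult_left_mono) auto
      then show ?thesis by simp
    qed
    finally have "1/2 * t * c + D < 0" using D by simp
    then show False using bound[OF t] t by (simp add: zero_le_mult_iff)
  qed
  ultimately show ?thesis unfolding g_def[symmetric] min sub by blast
qed

section \<open>Characterization of pattern recovery\<close>

text \<open>The vector \<open>\<pi>\<^sub>\<alpha>\<close> for the noise \<open>e\<close>.\<close>
definition dual_certificate ::
    "real ^ 'p ^ 'n \<Rightarrow> real ^ 'k ^ 'n \<Rightarrow> real ^ 'k \<Rightarrow> real \<Rightarrow> real ^ 'n \<Rightarrow> real ^ 'p" where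
  "dual_certificate X XM \<Lambda>M \<alpha> e =
     transpose X *v (pinv (transpose XM) *v \<Lambda>M)
       + (1 / \<alpha>) *\<^sub>R (transpose X *v ((mat 1 - col_proj XM) *v e))"

text \<open>
  The normal equation determines \<open>d\<close> only up to the kernel of \<open>XM\<close>, but it determines \<open>XM *v d\<close>:
  multiplying by \<open>pinv (transpose XM)\<close> turns its left-hand side into the projection of \<open>XM *v d\<close>,
  which is \<open>XM *v d\<close> itself.
\<close>
lemma dual_certificate_eq:
  assumes \<alpha>: "0 < \<alpha>"
    and normal_eq: "transpose XM *v (XM *v d) = \<alpha> *\<^sub>R \<Lambda>M - transpose XM *v e"
  shows "(1 / \<alpha>) *\<^sub>R (transpose X *v (XM *v d + e)) = dual_certificate X XM \<Lambda>M \<alpha> e"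
proof -
  have "XM *v d = pinv (transpose XM) *v (transpose XM *v (XM *v d))"
    by (simp add: matrix_vector_mul_assoc pinv_transpose_mult_transpose col_proj_mult matrix_mul_assoc)
  also have "\<dots> = \<alpha> *\<^sub>R (pinv (transpose XM) *v \<Lambda>M) - col_proj XM *v e"
    unfolding normal_eq
    by (simp add: matrix_vector_mult_diff_distrib matrix_vector_mult_scaleR
        matrix_vector_mul_assoc pinv_transpose_mult_transpose del: transpose_matrix_vector)
  finally have "XM *v d + e = \<alpha> *\<^sub>R (pinv (transpose XM) *v \<Lambda>M) + (mat 1 - col_proj XM) *v e"
    by (simp add: matrix_vector_mult_diff_rdistrib)
  then show ?thesis
    using \<alpha> by (simp add: dual_certificate_def matrix_vector_right_distrib
        matrix_vector_mult_scaleR scaleR_right_distrib del: transpose_matrix_vector)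
qed

lemma pattern_recovery_iff:
  fixes X :: "real ^ 'p::{finite,linorder} ^ 'n" and s :: "real ^ 'k::{finite,linorder}"
    and XM :: "real ^ 'k::{finite,linorder} ^ 'n"
  assumes \<Lambda>: "\<Lambda> \<in> decr_pos_vecs" and \<alpha>: "0 < \<alpha>"
    and s: "s \<in> decr_pos_vecs" and m: "pattern_levels M CARD('k) m"
    and XM: "XM = X_tilde X M" and \<Lambda>M: "\<Lambda>M = \<Lambda>_tilde \<Lambda> M"
  shows "(\<exists>b \<in> slope_minimizers X \<alpha> \<Lambda> (X *v (pattern_matrix M *v s) + e). patt b = M) \<longleftrightarrow>
    \<Lambda>M \<in> col_space (transpose XM) \<and>
    slope_dual_norm \<Lambda> (dual_certificate X XM \<Lambda>M \<alpha> e) \<le> 1 \<and>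
    (\<exists>t \<in> decr_pos_vecs. transpose XM *v (XM *v (s - t)) = \<alpha> *\<^sub>R \<Lambda>M - transpose XM *v e)"
proof -
  let ?U = "pattern_matrix M :: real ^ 'k::{finite,linorder} ^ 'p::{finite,linorder}"
  let ?Y = "X *v (?U *v s) + e"
  have XM': "XM = X ** ?U" by (simp add: XM X_tilde_def)
  define v where "v t = (1 / \<alpha>) *\<^sub>R (transpose X *v (XM *v (s - t) + e))" for t
  have resid: "?Y - X *v (?U *v t) = XM *v (s - t) + e" for t
    by (simp add: XM' matrix_vector_mult_diff_distrib flip: matrix_vector_mul_assoc)
  have Uv: "transpose ?U *v v t = \<Lambda>M \<longleftrightarrow>
      transpose XM *v (XM *v (s - t)) = \<alpha> *\<^sub>R \<Lambda>M - transpose XM *v e" for t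
  proof -
    have "transpose ?U *v v t = (1 / \<alpha>) *\<^sub>R (transpose XM *v (XM *v (s - t) + e))"
      by (simp add: v_def XM' matrix_transpose_mul matrix_vector_mult_scaleR
          matrix_vector_mul_assoc del: transpose_matrix_vector)
    then have "transpose ?U *v v t = \<Lambda>M \<longleftrightarrow> transpose XM *v (XM *v (s - t) + e) = \<alpha> *\<^sub>R \<Lambda>M"
      using \<alpha> by (auto simp del: transpose_matrix_vector simp: field_simps)
    then show ?thesis
      by (simp add: matrix_vector_right_distrib eq_diff_eq del: transpose_matrix_vector)
  qed
  have col: "\<Lambda>M \<in> col_space (transpose XM)"
    if "transpose XM *v (XM *v (s - t)) = \<alpha> *\<^sub>R \<Lambda>M - transpose XM *v e" for t
  proof -
    have "\<alpha> *\<^sub>R \<Lambda>M = transpose XM *v (XM *v (s - t) + e)"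
      using that by (simp add: matrix_vector_right_distrib del: transpose_matrix_vector)
    then have "transpose XM *v ((1 / \<alpha>) *\<^sub>R (XM *v (s - t) + e)) = (1 / \<alpha>) *\<^sub>R \<alpha> *\<^sub>R \<Lambda>M"
      by (simp only: matrix_vector_mult_scaleR)
    also have "\<dots> = \<Lambda>M" using \<alpha> by simp
    finally show ?thesis unfolding mem_col_space_iff by metis
  qed
  have cert: "v t = dual_certificate X XM \<Lambda>M \<alpha> e"
    if "transpose XM *v (XM *v (s - t)) = \<alpha> *\<^sub>R \<Lambda>M - transpose XM *v e" for t
    unfolding v_def by (rule dual_certificate_eq[OF \<alpha> that])
  have sub: "?U *v t \<in> slope_minimizers X \<alpha> \<Lambda> ?Y \<longleftrightarrow>
      slope_dual_norm \<Lambda> (v t) \<le> 1 \<and> transpose ?U *v v t = \<Lambda>M" if t: "t \<in> decr_pos_vecs" for t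
    unfolding slope_minimizers_iff[OF \<Lambda> \<alpha>] resid v_def[symmetric]
      subdifferential_slope_norm_pattern[OF \<Lambda> t m] \<Lambda>M ..
  have "(\<exists>b \<in> slope_minimizers X \<alpha> \<Lambda> ?Y. patt b = M) \<longleftrightarrow>
      (\<exists>t \<in> decr_pos_vecs. ?U *v t \<in> slope_minimizers X \<alpha> \<Lambda> ?Y)"
    unfolding patt_eq_iff[OF m] by blast
  also have "\<dots> \<longleftrightarrow> (\<exists>t \<in> decr_pos_vecs. slope_dual_norm \<Lambda> (v t) \<le> 1 \<and> transpose ?U *v v t = \<Lambda>M)"
    by (rule bex_cong[OF refl sub])
  also have "\<dots> \<longleftrightarrow> \<Lambda>M \<in> col_space (transpose XM) \<and>
    slope_dual_norm \<Lambda> (dual_certificate X XM \<Lambda>M \<alpha> e) \<le> 1 \<and>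
    (\<exists>t \<in> decr_pos_vecs. transpose XM *v (XM *v (s - t)) = \<alpha> *\<^sub>R \<Lambda>M - transpose XM *v e)"
    (is "_ \<longleftrightarrow> ?rhs")
    unfolding Uv
  proof (intro iffI; elim conjE bexE)
    fix t :: "real ^ 'k::{finite,linorder}"
    assume t: "t \<in> decr_pos_vecs" "slope_dual_norm \<Lambda> (v t) \<le> 1"
      and eq: "transpose XM *v (XM *v (s - t)) = \<alpha> *\<^sub>R \<Lambda>M - transpose XM *v e"
    show "?rhs"
    proof (intro conjI bexI)
      show "slope_dual_norm \<Lambda> (dual_certificate X XM \<Lambda>M \<alpha> e) \<le> 1" using t(2) by (simp only: cert[OF eq])
    qed (fact col[OF eq] eq t(1))+
  next
    fix t :: "real ^ 'k::{finite,linorder}"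
    assume t: "t \<in> decr_pos_vecs" "slope_dual_norm \<Lambda> (dual_certificate X XM \<Lambda>M \<alpha> e) \<le> 1"
      and eq: "transpose XM *v (XM *v (s - t)) = \<alpha> *\<^sub>R \<Lambda>M - transpose XM *v e"
    show "\<exists>t \<in> decr_pos_vecs. slope_dual_norm \<Lambda> (v t) \<le> 1 \<and>
        transpose XM *v (XM *v (s - t)) = \<alpha> *\<^sub>R \<Lambda>M - transpose XM *v e"
    proof (intro conjI bexI)
      show "slope_dual_norm \<Lambda> (v t) \<le> 1" using t(2) by (simp only: cert[OF eq])
    qed (fact eq t(1))+
  qed
  finally show ?thesis .
qed

text \<open>
  The minimum norm solution \<open>d = s - t\<close> of the normal equation, that is, the shrinkage of the
  coefficients by the penalty and the noise.
\<close>
definition signal_shift ::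
    "real ^ 'k ^ 'n \<Rightarrow> real ^ 'k \<Rightarrow> real \<Rightarrow> real ^ 'n \<Rightarrow> real ^ 'k" where
  "signal_shift XM \<Lambda>M \<alpha> e = pinv XM *v (\<alpha> *\<^sub>R (pinv (transpose XM) *v \<Lambda>M) - col_proj XM *v e)"

lemma signal_shift_solves:
  assumes "\<Lambda>M \<in> col_space (transpose XM)"
  shows "transpose XM *v (XM *v signal_shift XM \<Lambda>M \<alpha> e) = \<alpha> *\<^sub>R \<Lambda>M - transpose XM *v e"
proof -
  have "transpose XM *v (XM *v signal_shift XM \<Lambda>M \<alpha> e) =
      (transpose XM ** col_proj XM) *v (\<alpha> *\<^sub>R (pinv (transpose XM) *v \<Lambda>M) - col_proj XM *v e)"
    by (simp add: signal_shift_def col_proj_def matrix_vector_mul_assoc matrix_mul_assoc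
        del: transpose_matrix_vector)
  also have "\<dots> = \<alpha> *\<^sub>R (transpose XM *v (pinv (transpose XM) *v \<Lambda>M)) -
      (transpose XM ** col_proj XM) *v e"
    unfolding transpose_mult_col_proj
    by (simp add: matrix_vector_mult_diff_distrib matrix_vector_mult_scaleR
        matrix_vector_mul_assoc transpose_mult_col_proj del: transpose_matrix_vector)
  also have "\<dots> = \<alpha> *\<^sub>R \<Lambda>M - transpose XM *v e"
    using assms unfolding mem_col_space_iff_pinv transpose_mult_col_proj by simp
  finally show ?thesis .
qed

text \<open>
  Each entry of \<open>s\<close> exceeds all later ones, and 0, by at least the gap, and the perturbation moves
  two entries relative to each other by at most \<open>2 * norm d\<close>.
\<close>
lemma diff_mem_decr_pos_vecs:
  fixes s :: "real ^ 'k::{finite,linorder}"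
  assumes s: "s \<in> decr_pos_vecs" and d: "2 * norm d < min_gap s"
  shows "s - d \<in> decr_pos_vecs"
proof -
  have gap: "min_gap s \<le> s $ i - (if {i<..} = {} then 0 else s $ Min {i<..})" for i
    unfolding min_gap_def by (intro Min_le) auto
  have comp: "\<bar>d $ i\<bar> \<le> norm d" for i by (rule component_le_norm_cart)
  have "s $ j - d $ j < s $ i - d $ i" if "i < j" for i j
  proof -
    have ne: "{i<..} \<noteq> {}" using that by auto
    have "Min {i<..} \<le> j" using that by (intro Min_le) auto
    then have "s $ j \<le> s $ Min {i<..}" by (rule decr_pos_vecsD(2)[OF s])
    then show ?thesis using gap[of i] ne d comp[of i] comp[of j] by auto
  qed
  moreover have "0 < s $ i - d $ i" for i
  proof -
    have "0 \<le> (if {i<..} = {} then 0 else s $ Min {i<..})"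
      using decr_pos_vecsD(1)[OF s] by (simp add: less_imp_le)
    then show ?thesis using gap[of i] d comp[of i] norm_ge_zero[of d] by linarith
  qed
  ultimately show ?thesis by (simp add: decr_pos_vecs_def)
qed

lemma pattern_recovery_if_gap_large:
  fixes X :: "real ^ 'p::{finite,linorder} ^ 'n" and s :: "real ^ 'k::{finite,linorder}"
    and XM :: "real ^ 'k::{finite,linorder} ^ 'n"
  assumes \<Lambda>: "\<Lambda> \<in> decr_pos_vecs" and \<alpha>: "0 < \<alpha>"
    and s: "s \<in> decr_pos_vecs" and m: "pattern_levels M CARD('k) m"
    and XM: "XM = X_tilde X M" and \<Lambda>M: "\<Lambda>M = \<Lambda>_tilde \<Lambda> M"
    and col: "\<Lambda>M \<in> col_space (transpose XM)"
    and dual: "slope_dual_norm \<Lambda> (dual_certificate X XM \<Lambda>M \<alpha> e) \<le> 1"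
    and gap: "2 * norm (signal_shift XM \<Lambda>M \<alpha> e) < min_gap s"
  shows "\<exists>b \<in> slope_minimizers X \<alpha> \<Lambda> (X *v (pattern_matrix M *v s) + e). patt b = M"
  unfolding pattern_recovery_iff[OF \<Lambda> \<alpha> s m XM \<Lambda>M]
proof (intro conjI bexI)
  show "s - signal_shift XM \<Lambda>M \<alpha> e \<in> decr_pos_vecs"
    by (rule diff_mem_decr_pos_vecs[OF s gap])
  show "transpose XM *v (XM *v (s - (s - signal_shift XM \<Lambda>M \<alpha> e))) =
      \<alpha> *\<^sub>R \<Lambda>M - transpose XM *v e"
    using signal_shift_solves[OF col, of \<alpha> e] by simp
qed (fact col dual)+

section \<open>Limit of the recovery probability\<close>

lemma closed_slope_dual_ball:
  assumes "\<Lambda> \<in> decr_pos_vecs"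
  shows "closed {v. slope_dual_norm \<Lambda> v \<le> 1}"
proof -
  have "{v. slope_dual_norm \<Lambda> v \<le> 1} = (\<Inter>z. {v. z \<bullet> v \<le> slope_norm \<Lambda> z})"
    by (auto simp: slope_dual_norm_le_1_iff[OF assms] inner_commute)
  then show ?thesis by (simp add: closed_INT closed_halfspace_le)
qed

text \<open>
  Solvability within a compact set is a closed condition on \<open>e\<close>, as the preimage of a compact
  image; the open cone is a countable union of compact sets.
\<close>
lemma borel_normal_equation_solvable:
  fixes A :: "real ^ 'k::{finite,linorder} ^ 'n"
  shows "{e. \<exists>t \<in> decr_pos_vecs. transpose A *v (A *v (s - t)) = a - transpose A *v e} \<in> sets borel"
proof -
  obtain C :: "nat \<Rightarrow> (real ^ 'k::{finite,linorder}) set" where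
    C: "\<And>n. compact (C n)" "\<Union> (range C) = decr_pos_vecs"
    using open_Union_compact_subsets[OF open_decr_pos_vecs] by metis
  let ?g = "\<lambda>t. transpose A *v (A *v (s - t))" and ?h = "\<lambda>e. a - transpose A *v e"
  have "(\<Union>n. ?h -` (?g ` C n)) = ?h -` (?g ` decr_pos_vecs)"
    unfolding C(2)[symmetric] by blast
  also have "\<dots> = {e. \<exists>t \<in> decr_pos_vecs. ?g t = ?h e}"
    unfolding vimage_def image_iff by (intro Collect_cong bex_cong refl eq_commute)
  finally have "{e. \<exists>t \<in> decr_pos_vecs. ?g t = ?h e} = (\<Union>n. ?h -` (?g ` C n))" ..
  moreover have "?h -` (?g ` C n) \<in> sets borel" for n
  proof -
    have "compact (?g ` C n)"
      by (intro compact_continuous_image C(1) continuous_intros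
          linear_continuous_on_compose[OF _ matrix_vector_mul_linear])
    then have "closed (?h -` (?g ` C n))"
      by (intro closed_vimage compact_imp_closed continuous_intros
          linear_continuous_on_compose[OF _ matrix_vector_mul_linear]) 
    then show ?thesis by simp
  qed
  ultimately show ?thesis by auto
qed

lemma (in finite_measure) measure_tendsto_if_eventually_mem_iff:
  assumes A: "\<And>r. A r \<in> sets M" and B: "B \<in> sets M"
    and ev: "\<And>x. x \<in> space M \<Longrightarrow> \<forall>\<^sub>F r in sequentially. x \<in> A r \<longleftrightarrow> x \<in> B"
  shows "(\<lambda>r. measure M (A r)) \<longlonglongrightarrow> measure M B"
proof -
  have "(\<lambda>r. integral\<^sup>L M (indicat_real (A r))) \<longlonglongrightarrow> integral\<^sup>L M (indicat_real B)"
  proof (rule integral_dominated_convergence)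
    show "AE x in M. (\<lambda>r. indicat_real (A r) x) \<longlonglongrightarrow> indicat_real B x"
    proof (rule AE_I2)
      fix x assume "x \<in> space M"
      from ev[OF this] show "(\<lambda>r. indicat_real (A r) x) \<longlonglongrightarrow> indicat_real B x"
        by (intro tendsto_eventually) (auto elim!: eventually_mono simp: indicator_def)
    qed
    show "integrable M (\<lambda>_. 1 :: real)" by simp
  qed (use A B in \<open>auto simp: indicator_def\<close>)
  then show ?thesis using A B by simp
qed

section \<open>Affine hull of the subdifferential\<close>

text \<open>
  These signed rearrangements of the weights attain \<open>v \<bullet> M = slope_norm \<Lambda> M\<close>. Ties among the
  \<open>\<bar>M $ i\<bar>\<close> leave freedom in \<open>\<rho>\<close>, and zero entries leave freedom in the signs \<open>\<sigma>\<close>; both are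
  exploited below.
\<close>
lemma signed_rearrangement_mem_subdifferential:
  assumes \<Lambda>: "\<Lambda> \<in> decr_pos_vecs" and \<rho>: "sorts_abs \<rho> M"
    and \<sigma>: "\<And>i. \<bar>\<sigma> i\<bar> = 1" "\<And>i. \<sigma> i * M $ i = \<bar>M $ i\<bar>"
  shows "(\<chi> i. \<sigma> i * \<Lambda> $ inv \<rho> i) \<in> subdifferential (slope_norm \<Lambda>) M" (is "?v \<in> _")
proof -
  have bij: "bij \<rho>" using \<rho> by (simp add: sorts_abs_def)
  have inner: "?v \<bullet> z = (\<Sum>i\<in>UNIV. \<Lambda> $ i * (\<sigma> (\<rho> i) * z $ \<rho> i))" for z
  proof -
    have "?v \<bullet> z = (\<Sum>i\<in>UNIV. ?v $ \<rho> i * z $ \<rho> i)"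
      using sum.reindex_bij_betw[OF bij, of "\<lambda>i. ?v $ i * z $ i"] by (simp add: inner_vec_def)
    then show ?thesis using bij by (simp add: bij_is_inj mult.left_commute mult.assoc)
  qed
  have "?v \<bullet> z \<le> slope_norm \<Lambda> z" for z
  proof -
    have "\<sigma> i * x \<le> \<bar>x\<bar>" for i x
      using abs_ge_self[of "\<sigma> i * x"] by (simp add: abs_mult \<sigma>(1))
    then have "?v \<bullet> z \<le> (\<Sum>i\<in>UNIV. \<Lambda> $ i * \<bar>z $ \<rho> i\<bar>)"
      unfolding inner using decr_pos_vecsD(1)[OF \<Lambda>]
      by (intro sum_mono mult_left_mono) (auto simp: less_imp_le)
    then show ?thesis using slope_norm_ge[OF \<Lambda> bij] order_trans by blast
  qed
  moreover have "?v \<bullet> M = slope_norm \<Lambda> M"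
    unfolding inner \<sigma>(2) slope_norm_eq[OF \<rho>] ..
  ultimately show ?thesis
    unfolding mem_subdifferential_slope_norm_iff[OF \<Lambda>] slope_dual_norm_le_1_iff[OF \<Lambda>] by blast
qed

text \<open>
  If the functional \<open>w\<close> is constant on the subdifferential, compare its values on two signed
  rearrangements of the weights. Exchanging two entries with tied \<open>\<bar>M $ i\<bar>\<close> shows that the signed
  entries of \<open>w\<close> agree on them, because the two weights differ; flipping the sign at a zero entry
  of \<open>M\<close> shows that \<open>w\<close> vanishes there, because the weight is nonzero. These are the equations of
  the column space of the pattern matrix.
\<close>
lemma orthogonal_to_subdifferential_imp_pattern_matrix_mult:
  fixes w :: "real ^ 'p::{finite,linorder}"
  assumes \<Lambda>: "\<Lambda> \<in> decr_pos_vecs" and m: "pattern_levels M CARD('k) m"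
    and const: "\<And>v v'. v \<in> subdifferential (slope_norm \<Lambda>) M \<Longrightarrow>
      v' \<in> subdifferential (slope_norm \<Lambda>) M \<Longrightarrow> w \<bullet> v = w \<bullet> v'"
  shows "\<exists>t :: real ^ 'k::{finite,linorder}. w = pattern_matrix M *v t"
proof -
  obtain \<rho> where \<rho>: "sorts_abs \<rho> M" using sorts_abs_exists by blast
  then have bij: "bij \<rho>" by (simp add: sorts_abs_def)
  define \<sigma> where "\<sigma> i = (if M $ i < 0 then -1 else 1 :: real)" for i
  have \<sigma>: "\<bar>\<sigma> i\<bar> = 1" "\<sigma> i * M $ i = \<bar>M $ i\<bar>" for i by (auto simp: \<sigma>_def)
  let ?v = "\<chi> i. \<sigma> i * \<Lambda> $ inv \<rho> i"
  have v: "?v \<in> subdifferential (slope_norm \<Lambda>) M"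
    by (rule signed_rearrangement_mem_subdifferential[OF \<Lambda> \<rho> \<sigma>])
  have tied: "\<sigma> a * w $ a = \<sigma> b * w $ b" if ab: "\<bar>M $ a\<bar> = \<bar>M $ b\<bar>" for a b
  proof (cases "a = b")
    case False
    let ?\<tau> = "Transposition.transpose a b"
    have "\<bar>M $ ?\<tau> i\<bar> = \<bar>M $ i\<bar>" for i using ab by (auto simp: Transposition.transpose_def)
    then have \<rho>': "sorts_abs (?\<tau> \<circ> \<rho>) M"
      using \<rho> by (auto simp: sorts_abs_def intro: bij_comp)
    have inv: "inv (?\<tau> \<circ> \<rho>) i = inv \<rho> (?\<tau> i)" for i
      using bij by (simp add: o_inv_distrib)
    let ?x = "\<Lambda> $ inv \<rho> a" and ?y = "\<Lambda> $ inv \<rho> b"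
    let ?v' = "\<chi> i. \<sigma> i * \<Lambda> $ inv \<rho> (?\<tau> i)"
    have "?v' \<in> subdifferential (slope_norm \<Lambda>) M"
      using signed_rearrangement_mem_subdifferential[OF \<Lambda> \<rho>' \<sigma>] by (simp add: inv)
    then have "w \<bullet> (?v - ?v') = 0"
      using const[OF v] by (simp add: inner_diff_right)
    moreover have "?v - ?v' = axis a (\<sigma> a * (?x - ?y)) - axis b (\<sigma> b * (?x - ?y))"
      using False by (auto simp: vec_eq_iff axis_def Transposition.transpose_def algebra_simps)
    ultimately have "(?x - ?y) * (\<sigma> a * w $ a - \<sigma> b * w $ b) = 0"
      by (simp add: inner_diff_right inner_axis algebra_simps)
    moreover have "?x \<noteq> ?y"
    proof -
      have "inv \<rho> a \<noteq> inv \<rho> b" using False bij by (metis bij_inv_eq_iff)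
      then show ?thesis
        using decr_pos_vecsD(3)[OF \<Lambda>] by (metis less_irrefl linorder_less_linear)
    qed
    ultimately show ?thesis by simp
  qed simp
  have zero: "w $ a = 0" if a: "M $ a = 0" for a
  proof -
    let ?\<sigma>' = "\<sigma>(a := - \<sigma> a)"
    have "\<bar>?\<sigma>' i\<bar> = 1" "?\<sigma>' i * M $ i = \<bar>M $ i\<bar>" for i using \<sigma> a by auto
    from signed_rearrangement_mem_subdifferential[OF \<Lambda> \<rho> this]
    have "w \<bullet> (?v - (\<chi> i. ?\<sigma>' i * \<Lambda> $ inv \<rho> i)) = 0"
      using const[OF v] by (simp add: inner_diff_right)
    moreover have "?v - (\<chi> i. ?\<sigma>' i * \<Lambda> $ inv \<rho> i) = axis a (2 * \<sigma> a * \<Lambda> $ inv \<rho> a)"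
      by (auto simp: vec_eq_iff axis_def)
    ultimately have "\<sigma> a * \<Lambda> $ inv \<rho> a * w $ a = 0" by (auto simp: inner_axis)
    moreover have "\<sigma> a \<noteq> 0" using \<sigma>(1)[of a] by auto
    ultimately show ?thesis using decr_pos_vecsD(1)[OF \<Lambda>, of "inv \<rho> a"] by auto
  qed
  define c where "c q = (SOME i. m i = q)" for q
  define t :: "real ^ 'k::{finite,linorder}" where
    "t = (\<chi> j. \<sigma> (c (CARD('k) + 1 - pos j)) * w $ c (CARD('k) + 1 - pos j))"
  have "w $ i = (pattern_matrix M *v t) $ i" for i
  proof -
    have mi: "\<bar>M $ i\<bar> = real (m i)" "m i \<le> CARD('k)" using m by (auto simp: pattern_levels_def)
    show ?thesis
    proof (cases "m i = 0")
      case True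
      then show ?thesis using zero[of i] mi(1) pattern_matrix_mult[OF mi(1), of t] by simp
    next
      case False
      obtain j :: 'k where j: "pos j + m i = CARD('k) + 1"
        by (rule level_index_exists[of "m i"]) (use False mi(2) in auto)
      have "m (c (m i)) = m i" unfolding c_def by (rule someI_ex) blast
      then have "\<bar>M $ c (m i)\<bar> = \<bar>M $ i\<bar>" using m by (simp add: pattern_levels_def)
      then have "\<sigma> (c (m i)) * w $ c (m i) = \<sigma> i * w $ i" by (rule tied)
      moreover have "CARD('k) + 1 - pos j = m i" using j by simp
      ultimately have "level_value t (m i) = \<sigma> i * w $ i"
        unfolding level_value_eq[OF j] by (simp add: t_def)
      moreover have "sgn (M $ i) * \<sigma> i = 1" using False mi(1) by (auto simp: \<sigma>_def sgn_if)
      ultimately show ?thesis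
        unfolding pattern_matrix_mult[OF mi(1)] by (simp flip: mult.assoc)
    qed
  qed
  then show ?thesis by (auto simp: vec_eq_iff)
qed

text \<open>
  The component \<open>z\<close> of \<open>u\<close> orthogonal to the direction space of the affine hull is constant on the
  subdifferential, hence in the column space of the pattern matrix, to which \<open>u\<close> is orthogonal.
  So \<open>z\<close> is orthogonal to \<open>u\<close> and to \<open>u - z\<close>, and vanishes.
\<close>
lemma add_mem_affine_hull_subdifferential:
  assumes \<Lambda>: "\<Lambda> \<in> decr_pos_vecs" and m: "pattern_levels M CARD('k) m"
    and v: "v \<in> subdifferential (slope_norm \<Lambda>) M"
    and u: "transpose (pattern_matrix M :: real ^ 'k::{finite,linorder} ^ _) *v u = 0"
  shows "v + u \<in> affine hull (subdifferential (slope_norm \<Lambda>) M)"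
proof -
  let ?D = "(+) (- v) ` (subdifferential (slope_norm \<Lambda>) M - {v})"
  obtain y z where yz: "y \<in> span ?D" "\<And>d. d \<in> span ?D \<Longrightarrow> orthogonal z d" "u = y + z"
    using orthogonal_subspace_decomp_exists[of ?D u] by blast
  have "z \<bullet> v = z \<bullet> v'" if "v' \<in> subdifferential (slope_norm \<Lambda>) M" for v'
  proof (cases "v' = v")
    case False
    then have "- v + v' \<in> span ?D" using that by (intro span_base) auto
    then have "orthogonal z (- v + v')" by (rule yz(2))
    then show ?thesis by (simp add: orthogonal_def inner_diff_right)
  qed simp
  then have "z \<bullet> v' = z \<bullet> v''" if "v' \<in> subdifferential (slope_norm \<Lambda>) M"
    "v'' \<in> subdifferential (slope_norm \<Lambda>) M" for v' v'' using that by metis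
  then obtain t :: "real ^ 'k::{finite,linorder}" where "z = pattern_matrix M *v t"
    using orthogonal_to_subdifferential_imp_pattern_matrix_mult[OF \<Lambda> m] by blast
  then have "u \<bullet> z = 0" using u inner_transpose_mult[of "pattern_matrix M" u t] by simp
  moreover have "y \<bullet> z = 0" using yz(1,2) by (simp add: orthogonal_def inner_commute)
  ultimately have "z = 0" using yz(3) by (simp add: inner_add_left)
  then show ?thesis using yz(1,3) by (simp add: affine_hull_span2[OF v])
qed

section \<open>Pattern recovery for signals of increasing strength\<close>

lemma tendsto_probability_pattern_recovery:
  fixes X :: "real ^ 'p::{finite,linorder} ^ 'n" and s :: "nat \<Rightarrow> real ^ 'k::{finite,linorder}"
    and XM :: "real ^ 'k::{finite,linorder} ^ 'n"
  assumes \<Lambda>: "\<Lambda> \<in> decr_pos_vecs" and \<alpha>: "0 < \<alpha>"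
    and s: "\<And>r. s r \<in> decr_pos_vecs" and m: "pattern_levels M CARD('k) m"
    and gap: "filterlim (\<lambda>r. min_gap (s r)) at_top sequentially"
    and XM: "XM = X_tilde X M" and \<Lambda>M: "\<Lambda>M = \<Lambda>_tilde \<Lambda> M"
    and col: "\<Lambda>M \<in> col_space (transpose XM)"
    and P: "prob_space P" and \<epsilon>: "\<epsilon> \<in> borel_measurable P"
  shows "(\<lambda>r. measure P {\<omega> \<in> space P.
      \<exists>b \<in> slope_minimizers X \<alpha> \<Lambda> (X *v (pattern_matrix M *v s r) + \<epsilon> \<omega>). patt b = M})
    \<longlonglongrightarrow> measure P {\<omega> \<in> space P. slope_dual_norm \<Lambda> (dual_certificate X XM \<Lambda>M \<alpha> (\<epsilon> \<omega>)) \<le> 1}"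
proof -
  interpret prob_space P by (rule P)
  define D where "D = {e. slope_dual_norm \<Lambda> (dual_certificate X XM \<Lambda>M \<alpha> e) \<le> 1}"
  define N where "N r = {e. \<exists>t \<in> decr_pos_vecs.
      transpose XM *v (XM *v (s r - t)) = \<alpha> *\<^sub>R \<Lambda>M - transpose XM *v e}" for r
  have recov: "(\<exists>b \<in> slope_minimizers X \<alpha> \<Lambda> (X *v (pattern_matrix M *v s r) + e). patt b = M)
      \<longleftrightarrow> e \<in> D \<inter> N r" for r e
    unfolding pattern_recovery_iff[OF \<Lambda> \<alpha> s m XM \<Lambda>M] D_def N_def using col by blast
  have "closed D"
  proof -
    have "D = dual_certificate X XM \<Lambda>M \<alpha> -` {v. slope_dual_norm \<Lambda> v \<le> 1}"
      by (auto simp: D_def)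
    moreover have "continuous_on UNIV (dual_certificate X XM \<Lambda>M \<alpha>)"
      unfolding dual_certificate_def
      by (intro continuous_intros linear_continuous_on_compose[OF _ matrix_vector_mul_linear])
    ultimately show ?thesis by (simp only: closed_vimage[OF closed_slope_dual_ball[OF \<Lambda>]])
  qed
  then have D: "D \<in> sets borel" by simp
  have N: "N r \<in> sets borel" for r
    unfolding N_def by (rule borel_normal_equation_solvable)
  have "(\<lambda>r. measure P (\<epsilon> -` (D \<inter> N r) \<inter> space P)) \<longlonglongrightarrow> measure P (\<epsilon> -` D \<inter> space P)"
  proof (rule measure_tendsto_if_eventually_mem_iff)
    show "\<epsilon> -` (D \<inter> N r) \<inter> space P \<in> sets P" for r
      using \<epsilon> D N by (intro measurable_sets[OF \<epsilon>]) auto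
    show "\<epsilon> -` D \<inter> space P \<in> sets P" using \<epsilon> D by (rule measurable_sets)
    fix \<omega> assume \<omega>: "\<omega> \<in> space P"
    have "\<forall>\<^sub>F r in sequentially. 2 * norm (signal_shift XM \<Lambda>M \<alpha> (\<epsilon> \<omega>)) < min_gap (s r)"
      using gap by (auto simp: filterlim_at_top_dense)
    then show "\<forall>\<^sub>F r in sequentially.
        \<omega> \<in> \<epsilon> -` (D \<inter> N r) \<inter> space P \<longleftrightarrow> \<omega> \<in> \<epsilon> -` D \<inter> space P"
    proof (eventually_elim)
      case (elim r)
      have "\<epsilon> \<omega> \<in> D \<inter> N r" if "\<epsilon> \<omega> \<in> D"
        using pattern_recovery_if_gap_large[OF \<Lambda> \<alpha> s m XM \<Lambda>M col _ elim] that
        unfolding recov by (simp add: D_def)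
      then show ?case using \<omega> by auto
    qed
  qed
  moreover have "{\<omega> \<in> space P.
      \<exists>b \<in> slope_minimizers X \<alpha> \<Lambda> (X *v (pattern_matrix M *v s r) + \<epsilon> \<omega>). patt b = M}
      = \<epsilon> -` (D \<inter> N r) \<inter> space P" for r
    unfolding recov by auto
  moreover have "{\<omega> \<in> space P. slope_dual_norm \<Lambda> (dual_certificate X XM \<Lambda>M \<alpha> (\<epsilon> \<omega>)) \<le> 1}
      = \<epsilon> -` D \<inter> space P"
    by (auto simp: D_def)
  ultimately show ?thesis by simp
qed

lemma eventually_pattern_recovery:
  fixes X :: "real ^ 'p::{finite,linorder} ^ 'n" and s :: "nat \<Rightarrow> real ^ 'k::{finite,linorder}"
    and XM :: "real ^ 'k::{finite,linorder} ^ 'n"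
  assumes \<Lambda>: "\<Lambda> \<in> decr_pos_vecs" and \<alpha>: "\<And>r. r \<ge> 1 \<Longrightarrow> 0 < \<alpha> r"
    and s: "\<And>r. r \<ge> 1 \<Longrightarrow> s r \<in> decr_pos_vecs" and m: "pattern_levels M CARD('k) m"
    and gap: "filterlim (\<lambda>r. min_gap (s r)) at_top sequentially"
    and \<alpha>_top: "filterlim \<alpha> at_top sequentially"
    and ratio: "(\<lambda>r. \<alpha> r / min_gap (s r)) \<longlonglongrightarrow> 0"
    and XM: "XM = X_tilde X M" and \<Lambda>M: "\<Lambda>M = \<Lambda>_tilde \<Lambda> M"
    and ri: "transpose X *v (pinv (transpose XM) *v \<Lambda>M)
      \<in> rel_interior (subdifferential (slope_norm \<Lambda>) M)"
  shows "\<forall>\<^sub>F r in sequentially.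
    \<exists>b \<in> slope_minimizers X (\<alpha> r) \<Lambda> (X *v (pattern_matrix M *v s r) + e). patt b = M"
proof -
  let ?C = "subdifferential (slope_norm \<Lambda>) M"
  let ?U = "pattern_matrix M :: real ^ 'k::{finite,linorder} ^ 'p::{finite,linorder}"
  define v where "v = transpose X *v (pinv (transpose XM) *v \<Lambda>M)"
  define u where "u = transpose X *v ((mat 1 - col_proj XM) *v e)"
  have XM': "XM = X ** ?U" by (simp add: XM X_tilde_def)
  have UX: "transpose ?U *v (transpose X *v y) = transpose XM *v y" for y
    by (simp add: XM' matrix_transpose_mul matrix_vector_mul_assoc del: transpose_matrix_vector)
  obtain s0 :: "real ^ 'k::{finite,linorder}" where s0: "s0 \<in> decr_pos_vecs" "?U *v s0 = M"
    using pattern_matrix_mult_levels[OF m] .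
  have sub: "x \<in> ?C \<longleftrightarrow> slope_dual_norm \<Lambda> x \<le> 1 \<and> transpose ?U *v x = \<Lambda>M" for x
    using subdifferential_slope_norm_pattern[OF \<Lambda> s0(1) m] unfolding s0(2) \<Lambda>M .
  obtain \<delta> where \<delta>: "0 < \<delta>" "ball v \<delta> \<inter> affine hull ?C \<subseteq> ?C" and vC: "v \<in> ?C"
    using ri unfolding mem_rel_interior_ball v_def by blast
  have col: "\<Lambda>M \<in> col_space (transpose XM)"
    using vC unfolding sub v_def UX mem_col_space_iff_pinv by blast
  have u0: "transpose ?U *v u = 0"
    unfolding u_def UX
    by (simp add: matrix_vector_mult_diff_rdistrib matrix_vector_mult_diff_distrib
        matrix_vector_mul_assoc transpose_mult_col_proj del: transpose_matrix_vector)
  have dual: "\<forall>\<^sub>F r in sequentially. slope_dual_norm \<Lambda> (dual_certificate X XM \<Lambda>M (\<alpha> r) e) \<le> 1"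
  proof -
    have "\<forall>\<^sub>F r in sequentially. norm u / \<delta> < \<alpha> r"
      using \<alpha>_top by (auto simp: filterlim_at_top_dense)
    with eventually_ge_at_top[of 1] show ?thesis
    proof eventually_elim
      case (elim r)
      have pos: "0 < \<alpha> r" by (rule \<alpha>[OF elim(1)])
      let ?w = "(1 / \<alpha> r) *\<^sub>R u"
      have "norm ?w < \<delta>" using elim(2) pos \<delta>(1) by (simp add: field_simps)
      then have "v + ?w \<in> ball v \<delta>" by (simp add: dist_norm)
      moreover have "v + ?w \<in> affine hull ?C"
      proof (rule add_mem_affine_hull_subdifferential[OF \<Lambda> m vC])
        show "transpose ?U *v ?w = 0" by (simp only: matrix_vector_mult_scaleR u0 scaleR_zero_right)
      qed
      ultimately have "v + ?w \<in> ?C" using \<delta>(2) by blast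
      then show ?case unfolding sub by (simp add: dual_certificate_def u_def v_def)
    qed
  qed
  define A where "A = norm (pinv XM *v (pinv (transpose XM) *v \<Lambda>M))"
  define B where "B = norm (pinv XM *v (col_proj XM *v e))"
  have shift: "norm (signal_shift XM \<Lambda>M a e) \<le> a * A + B" if "0 < a" for a
    using norm_triangle_ineq4[of "a *\<^sub>R (pinv XM *v (pinv (transpose XM) *v \<Lambda>M))"] that
    by (simp add: signal_shift_def A_def B_def matrix_vector_mult_diff_distrib
        matrix_vector_mult_scaleR del: transpose_matrix_vector)
  have AB: "0 \<le> A" "0 \<le> B" by (simp_all add: A_def B_def)
  \<comment> \<open>each of \<open>2 * \<alpha> r * A\<close> and \<open>2 * B\<close> is eventually at most half of the gap\<close>
  have "\<forall>\<^sub>F r in sequentially. 4 * B + 1 < min_gap (s r)"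
    using gap by (auto simp: filterlim_at_top_dense)
  moreover have "\<forall>\<^sub>F r in sequentially. \<alpha> r / min_gap (s r) < 1 / (4 * (A + 1))"
    using order_tendstoD(2)[OF ratio, of "1 / (4 * (A + 1))"] AB by simp
  ultimately have "\<forall>\<^sub>F r in sequentially. 1 \<le> r \<and>
      2 * norm (signal_shift XM \<Lambda>M (\<alpha> r) e) < min_gap (s r)"
    using eventually_ge_at_top[of 1]
  proof eventually_elim
    case (elim r)
    have pos: "0 < \<alpha> r" by (rule \<alpha>[OF elim(3)])
    have "0 < min_gap (s r)" using elim(1) AB by linarith
    then have "4 * (\<alpha> r * A + \<alpha> r) < min_gap (s r)"
      using elim(2) AB by (simp add: field_simps)
    moreover have "2 * x < g" if "4 * (p + a) < g" "x \<le> p + B" "4 * B + 1 < g" "0 < a" for x g p a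
      using that by (simp add: algebra_simps)
    ultimately show ?case using shift[OF pos] elim(1,3) pos by blast
  qed
  with dual show ?thesis
  proof eventually_elim
    case (elim r)
    then show ?case
      using pattern_recovery_if_gap_large[OF \<Lambda> \<alpha> s m XM \<Lambda>M col] by blast
  qed
qed

theorem theorem4p1:
  fixes X :: "real ^ 'p::{finite,linorder} ^ 'n"
    and M \<Lambda> :: "real ^ 'p::{finite,linorder}"
    and s :: "nat \<Rightarrow> real ^ 'k::{finite,linorder}"
    and \<beta> :: "nat \<Rightarrow> real ^ 'p::{finite,linorder}"
    and XM :: "real ^ 'k::{finite,linorder} ^ 'n"
    and \<Lambda>M :: "real ^ 'k::{finite,linorder}"
  assumes M_pattern: "M \<in> slope_patterns" and M_nonzero: "M \<noteq> 0"
    and k: "real CARD('k) = infnorm M"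
    and \<Lambda>: "\<Lambda> \<in> decr_pos_vecs"
    and s: "\<And>r. r \<ge> 1 \<Longrightarrow> s r \<in> decr_pos_vecs"
    and \<beta>: "\<And>r. r \<ge> 1 \<Longrightarrow> \<beta> r = pattern_matrix M *v s r"
    and gap: "filterlim (\<lambda>r. min_gap (s r)) at_top sequentially"
    and XM: "XM = X_tilde X M"
    and \<Lambda>M: "\<Lambda>M = \<Lambda>_tilde \<Lambda> M"
  shows
    "(\<forall>(P :: 'w measure) (\<epsilon> :: 'w \<Rightarrow> real ^ 'n) (\<alpha> :: real).
        prob_space P \<longrightarrow> \<epsilon> \<in> borel_measurable P \<longrightarrow> \<alpha> > 0 \<longrightarrow>
        (\<lambda>r. measure P {\<omega> \<in> space P.
             \<exists>b \<in> slope_minimizers X \<alpha> \<Lambda> (X *v \<beta> r + \<epsilon> \<omega>). patt b = M})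
        \<longlonglongrightarrow>
        (if \<Lambda>M \<in> col_space (transpose XM)
         then measure P {\<omega> \<in> space P.
                slope_dual_norm \<Lambda>
                  (transpose X *v (pinv (transpose XM) *v \<Lambda>M)
                   + (1 / \<alpha>) *\<^sub>R (transpose X *v ((mat 1 - col_proj XM) *v \<epsilon> \<omega>))) \<le> 1}
         else 0))
     \<and>
     (\<forall>\<alpha> :: nat \<Rightarrow> real.
        (\<forall>r\<ge>1. \<alpha> r > 0) \<longrightarrow>
        filterlim \<alpha> at_top sequentially \<longrightarrow>
        (\<lambda>r. \<alpha> r / min_gap (s r)) \<longlonglongrightarrow> 0 \<longrightarrow>
        transpose X *v (pinv (transpose XM) *v \<Lambda>M)
          \<in> rel_interior (subdifferential (slope_norm \<Lambda>) M) \<longrightarrow>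
        (\<forall>\<epsilon> :: real ^ 'n. \<exists>r0>0. \<forall>r\<ge>r0.
           \<exists>b \<in> slope_minimizers X (\<alpha> r) \<Lambda> (X *v \<beta> r + \<epsilon>). patt b = M))"
proof (intro conjI allI impI)
  obtain m where m: "pattern_levels M CARD('k) m"
    using pattern_levels_exists[OF M_pattern M_nonzero k] .
  have s': "s (Suc r) \<in> decr_pos_vecs" and \<beta>': "\<beta> (Suc r) = pattern_matrix M *v s (Suc r)" for r
    using s \<beta> by simp_all
  {
    fix P :: "'w measure" and \<epsilon> :: "'w \<Rightarrow> real ^ 'n" and \<alpha> :: real
    assume P: "prob_space P" and \<epsilon>: "\<epsilon> \<in> borel_measurable P" and \<alpha>: "\<alpha> > 0"
    let ?prob = "\<lambda>r. measure P {\<omega> \<in> space P.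
      \<exists>b \<in> slope_minimizers X \<alpha> \<Lambda> (X *v \<beta> r + \<epsilon> \<omega>). patt b = M}"
    \<comment> \<open>\<open>\<beta> 0\<close> and \<open>s 0\<close> are arbitrary, so the sequence is shifted by one\<close>
    have "(\<lambda>r. ?prob (Suc r)) \<longlonglongrightarrow> (if \<Lambda>M \<in> col_space (transpose XM)
      then measure P {\<omega> \<in> space P. slope_dual_norm \<Lambda> (dual_certificate X XM \<Lambda>M \<alpha> (\<epsilon> \<omega>)) \<le> 1}
      else 0)"
    proof (cases "\<Lambda>M \<in> col_space (transpose XM)")
      case True
      have "filterlim (\<lambda>r. min_gap (s (Suc r))) at_top sequentially"
        using filterlim_compose[OF gap filterlim_Suc] .
      from tendsto_probability_pattern_recovery[OF \<Lambda> \<alpha> s' m this XM \<Lambda>M True P \<epsilon>] True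
      show ?thesis by (simp only: \<beta>' if_True)
    next
      case False
      then have "\<not> (\<exists>b \<in> slope_minimizers X \<alpha> \<Lambda> (X *v \<beta> (Suc r) + e). patt b = M)" for r e
        unfolding \<beta>' pattern_recovery_iff[OF \<Lambda> \<alpha> s' m XM \<Lambda>M] by blast
      then have "?prob (Suc r) = 0" for r by simp
      then show ?thesis using False by simp
    qed
    then show "?prob \<longlonglongrightarrow> (if \<Lambda>M \<in> col_space (transpose XM)
         then measure P {\<omega> \<in> space P.
                slope_dual_norm \<Lambda>
                  (transpose X *v (pinv (transpose XM) *v \<Lambda>M)
                   + (1 / \<alpha>) *\<^sub>R (transpose X *v ((mat 1 - col_proj XM) *v \<epsilon> \<omega>))) \<le> 1}
         else 0)"
      unfolding dual_certificate_def by (rule LIMSEQ_imp_Suc)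
  }
  {
    fix \<alpha> :: "nat \<Rightarrow> real" and \<epsilon> :: "real ^ 'n"
    assume \<alpha>: "\<forall>r\<ge>1. \<alpha> r > 0" "filterlim \<alpha> at_top sequentially"
      "(\<lambda>r. \<alpha> r / min_gap (s r)) \<longlonglongrightarrow> 0"
      and ri: "transpose X *v (pinv (transpose XM) *v \<Lambda>M)
        \<in> rel_interior (subdifferential (slope_norm \<Lambda>) M)"
    have pos: "\<And>r. r \<ge> 1 \<Longrightarrow> 0 < \<alpha> r" using \<alpha>(1) by simp
    obtain r1 where r1: "\<forall>r\<ge>r1.
        \<exists>b \<in> slope_minimizers X (\<alpha> r) \<Lambda> (X *v (pattern_matrix M *v s r) + \<epsilon>). patt b = M"
      using eventually_pattern_recovery[OF \<Lambda> pos s m gap \<alpha>(2,3) XM \<Lambda>M ri]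
      unfolding eventually_sequentially by blast
    show "\<exists>r0>0. \<forall>r\<ge>r0. \<exists>b \<in> slope_minimizers X (\<alpha> r) \<Lambda> (X *v \<beta> r + \<epsilon>). patt b = M"
    proof (intro exI[of _ "max 1 r1"] conjI allI impI)
      fix r assume "max 1 r1 \<le> r"
      then show "\<exists>b \<in> slope_minimizers X (\<alpha> r) \<Lambda> (X *v \<beta> r + \<epsilon>). patt b = M"
        using r1 \<beta>[of r] by simp
    qed simp
  }
qed

end
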